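(* Let $S$ be a metric space with metric $d$ and let $\mathcal{U}$ be a uniform structure on $\mathsf{P_t}(S)$. If $\mathcal{U}$ has properties (A1) and (A2), then the following statements are equivalent for any two sequences $\{\mu_j\}_{j}$ and $\{\nu_j\}_{j}$, $j=0,1,\dotsc$, in $\mathsf{P_t}(S)$: (i) $\lim_j \left(\int f\,\mathrm{d}\mu_j - \int f\,\mathrm{d}\nu_j\right)=0$ for every $f\in\mathsf{U_b}(S)$. (ii) The sequence $\{\mu_j\}_j$ is an asymptotic $\mathcal{U}$-approximation of the sequence $\{\nu_j\}_j$. (iii) $\lim_j \lVert \mu_j-\nu_j\rVert^\ast=0$. (iv) There exist $S$-valued random variables $X_j$, $Y_j$, $j=0,1,\dotsc$, whose distributions are $\mu_j$ and $\nu_j$ respectively, such that $\lim_j d(X_j,Y_j)=0$ almost surely.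
   Context: For a metric space $S$ with metric $d$: $\mathsf{C_b}(S)$ is the space of bounded real-valued continuous functions on $S$, $\mathsf{U_b}(S)$ the space of bounded real-valued uniformly continuous functions on $S$. A measure on $S$ means a bounded signed measure $\mu$ on the Borel $\sigma$-algebra of $S$; it is tight if $|\mu|(A)=\sup\{|\mu|(C)\mid C \text{ compact}, C\subseteq A\}$ for every Borel $A\subseteq S$. $\mathsf{M_t}(S)$ is the vector space of tight measures on $S$, and $\mathsf{P_t}(S)=\{\mu\in\mathsf{M_t}(S)\mid \mu\ge 0,\ \mu(S)=1\}$. For $\mu\in\mathsf{M_t}(S)$, $\lVert\mu\rVert^\ast:=\sup\int f\,\mathrm{d}\mu$, the supremum being over all $f\colon S\to\mathbb{R}$ with $\sup_{x\in S}|f(x)|\le 1$ and $|f(x)-f(y)|\le d(x,y)$ for all $x,y\in S$. If $\varphi\colon S\to S'$ is a continuous map of metric spaces, $\mathsf{M_t}(\varphi)\colon \mathsf{M_t}(S)\to\mathsf{M_t}(S')$ is the linear map defined by $\int g\,\mathrm{d}\,\mathsf{M_t}(\varphi)(\mu)=\int g\circ\varphi\,\mathrm{d}\mu$ for all $g\in\mathsf{C_b}(S')$ (push-forward); it maps $\mathsf{P_t}(S)$ into $\mathsf{P_t}(S')$. Given a uniform structure $\mathcal{U}$ on a set $A$, a net $\{a_\gamma\}_\gamma$ in $A$ is an asymptotic $\mathcal{U}$-approximation of a net $\{b_\gamma\}_\gamma$ in $A$ (same index set) iff $\lim_\gamma\Delta(a_\gamma,b_\gamma)=0$ for every $\mathcal{U}$-uniformly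 continuous pseudometric $\Delta$ on $A$. Sequences are indexed by $0,1,2,\dotsc$. For $n=1,2,\dotsc$ let $I_n=[-n,n]\subseteq\mathbb{R}$ with the standard metric. The $\mathsf{C_b}(I_n)$-weak topology on $\mathsf{P_t}(I_n)$ (the topology of simple convergence on elements of $\mathsf{C_b}(I_n)$) is compact, and there is a unique uniformity on $\mathsf{P_t}(I_n)$ compatible with it. Properties of a uniform structure $\mathcal{U}$ on $\mathsf{P_t}(S)$: (A1) If $X_j$ and $Y_j$, $j=0,1,\dotsc$, are $S$-valued random variables (defined on a common probability space) with distributions $\mu_j\in\mathsf{P_t}(S)$ and $\nu_j\in\mathsf{P_t}(S)$ respectively, and if $\lim_j d(X_j,Y_j)=0$ almost surely, then the sequence $\{\mu_j\}_j$ is an asymptotic $\mathcal{U}$-approximation of the sequence $\{\nu_j\}_j$. (A2) For every $n=1,2,\dotsc$, if a mapping $\varphi\colon S\to I_n$ is uniformly continuous, then so is the mapping $\mathsf{M_t}(\varphi)$ from $\mathsf{P_t}(S)$ with $\mathcal{U}$ to $\mathsf{P_t}(I_n)$ with its unique uniformity compatible with the $\mathsf{C_b}(I_n)$-weak topology. In statement (iv), likewise, all the random variables $X_j,Y_j$ are defined on a common probability space. *)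

theory Defs
  imports "HOL-Probability.Probability"
begin

section \<open>Uniform structures on a set\<close>

text \<open>
  A uniform structure on a set \<open>A\<close> is given by its filter of entourages, as in the class
  \<^class>\<open>uniform_space\<close>, but relative to a carrier: a property of pairs holds eventually iff it
  holds on some entourage, and \<open>A \<times> A\<close> is an entourage. No separation axiom is required.
\<close>

definition uniform_structure_on :: "'p set \<Rightarrow> ('p \<times> 'p) filter \<Rightarrow> bool" where
  "uniform_structure_on A U \<longleftrightarrow>
     U \<le> principal (A \<times> A) \<and>
     (\<forall>E. eventually E U \<longrightarrow> (\<forall>x\<in>A. E (x, x))) \<and>
     (\<forall>E. eventually E U \<longrightarrow> eventually (\<lambda>(x, y). E (y, x)) U) \<and>
     (\<forall>E. eventually E U \<longrightarrow>
        (\<exists>D. eventually D U \<and> (\<forall>x y z. D (x, y) \<longrightarrow> D (y, z) \<longrightarrow> E (x, z))))"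

definition uniformly_continuous_wrt ::
    "('p \<times> 'p) filter \<Rightarrow> ('q \<times> 'q) filter \<Rightarrow> ('p \<Rightarrow> 'q) \<Rightarrow> bool" where
  "uniformly_continuous_wrt U V f \<longleftrightarrow> (LIM (x, y) U. (f x, f y) :> V)"

text \<open>The product uniformity, by the same formula as \<open>uniformity_prod_def\<close>.\<close>

definition prod_uniformity ::
    "('p \<times> 'p) filter \<Rightarrow> ('q \<times> 'q) filter \<Rightarrow> (('p \<times> 'q) \<times> ('p \<times> 'q)) filter" where
  "prod_uniformity U V = filtermap (\<lambda>((x1, x2), (y1, y2)). ((x1, y1), (x2, y2))) (U \<times>\<^sub>F V)"

definition pseudometric_on :: "'p set \<Rightarrow> ('p \<Rightarrow> 'p \<Rightarrow> real) \<Rightarrow> bool" where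
  "pseudometric_on A \<Delta> \<longleftrightarrow>
     (\<forall>x\<in>A. \<Delta> x x = 0) \<and>
     (\<forall>x\<in>A. \<forall>y\<in>A. 0 \<le> \<Delta> x y \<and> \<Delta> x y = \<Delta> y x) \<and>
     (\<forall>x\<in>A. \<forall>y\<in>A. \<forall>z\<in>A. \<Delta> x z \<le> \<Delta> x y + \<Delta> y z)"

text \<open>The filter \<open>F\<close> is the filter of tails of the common index set of the two nets.\<close>

definition asymptotic_approximation ::
    "'p set \<Rightarrow> ('p \<times> 'p) filter \<Rightarrow> 'i filter \<Rightarrow> ('i \<Rightarrow> 'p) \<Rightarrow> ('i \<Rightarrow> 'p) \<Rightarrow> bool" where
  "asymptotic_approximation A U F a b \<longleftrightarrow>
     (\<forall>\<Delta>. pseudometric_on A \<Delta> \<and>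
          uniformly_continuous_wrt (prod_uniformity U U) uniformity (\<lambda>(x, y). \<Delta> x y) \<longrightarrow>
          ((\<lambda>\<gamma>. \<Delta> (a \<gamma>) (b \<gamma>)) \<longlongrightarrow> 0) F)"

definition uniformity_compatible_with :: "'p topology \<Rightarrow> ('p \<times> 'p) filter \<Rightarrow> bool" where
  "uniformity_compatible_with T V \<longleftrightarrow>
     uniform_structure_on (topspace T) V \<and>
     (\<forall>W. openin T W \<longleftrightarrow>
        W \<subseteq> topspace T \<and> (\<forall>x\<in>W. \<forall>\<^sub>F (x', y) in V. x' = x \<longrightarrow> y \<in> W))"


section \<open>Tight probability measures and their weak topology\<close>

text \<open>
  A metric space is a subset \<open>K\<close> of a type of class \<^class>\<open>metric_space\<close>; its Borel
  \<open>\<sigma>\<close>-algebra is the trace on \<open>K\<close> of that of the type.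
\<close>

definition tight_prob_measures :: "'a::metric_space set \<Rightarrow> 'a measure set" where
  "tight_prob_measures K =
     {\<mu>. sets \<mu> = sets (restrict_space borel K) \<and> prob_space \<mu> \<and>
         (\<forall>A\<in>sets \<mu>. emeasure \<mu> A = (SUP C\<in>{C. compact C \<and> C \<subseteq> A}. emeasure \<mu> C))}"

definition bounded_continuous_on :: "'a::metric_space set \<Rightarrow> ('a \<Rightarrow> real) set" where
  "bounded_continuous_on K = {g. continuous_on K g \<and> bounded (g ` K)}"

definition bounded_uniformly_continuous_on :: "'a::metric_space set \<Rightarrow> ('a \<Rightarrow> real) set" where
  "bounded_uniformly_continuous_on K = {f. uniformly_continuous_on K f \<and> bounded (f ` K)}"

definition weak_topology :: "'a::metric_space set \<Rightarrow> 'a measure topology" where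
  "weak_topology K =
     pullback_topology (tight_prob_measures K)
       (\<lambda>\<mu>. \<lambda>g\<in>bounded_continuous_on K. (\<integral>x. g x \<partial>\<mu>))
       (product_topology (\<lambda>_. euclideanreal) (bounded_continuous_on K))"

lemma ex_uniformity_compatible_with_weak_topology:
  "\<exists>V. uniformity_compatible_with (weak_topology K) V"
proof -
  define P where "P = tight_prob_measures K"
  define I where "I = bounded_continuous_on K"
  define ev where "ev \<mu> g = (\<integral>x. g x \<partial>\<mu>)" for \<mu> and g :: "'a \<Rightarrow> real"
  let ?f = "\<lambda>\<mu>. \<lambda>g\<in>I. ev \<mu> g"
  let ?T = "product_topology (\<lambda>_. euclideanreal) I"
  have T: "weak_topology K = pullback_topology P ?f ?T"
    unfolding weak_topology_def P_def I_def ev_def ..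
  have top: "topspace (weak_topology K) = P"
    unfolding T topspace_pullback_topology by auto
  define B where "B J e = {(x, y) \<in> P \<times> P. \<forall>g\<in>J. \<bar>ev x g - ev y g\<bar> < e}"
    for J and e :: real
  define X where "X = {J. finite J \<and> J \<subseteq> I} \<times> {e::real. 0 < e}"
  define V where "V = (INF (J, e)\<in>X. principal (B J e))"
  have X0: "X \<noteq> {}" unfolding X_def by (auto intro: exI[of _ 1])
  have evV: "eventually E V \<longleftrightarrow> (\<exists>J e. finite J \<and> J \<subseteq> I \<and> 0 < e \<and> (\<forall>p\<in>B J e. E p))" for E
  proof -
    have "eventually E V \<longleftrightarrow> (\<exists>b\<in>X. eventually E (case b of (J, e) \<Rightarrow> principal (B J e)))"
      unfolding V_def
    proof (rule eventually_INF_base[OF X0])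
      fix a b assume "a \<in> X" "b \<in> X"
      then obtain J e J' e' where ab: "a = (J, e)" "b = (J', e')"
        "finite J" "J \<subseteq> I" "0 < e" "finite J'" "J' \<subseteq> I" "0 < e'"
        unfolding X_def by auto
      then show "\<exists>x\<in>X. (case x of (J, e) \<Rightarrow> principal (B J e)) \<le>
          inf (case a of (J, e) \<Rightarrow> principal (B J e)) (case b of (J, e) \<Rightarrow> principal (B J e))"
        by (intro bexI[of _ "(J \<union> J', min e e')"]) (auto simp: X_def B_def)
    qed
    then show ?thesis by (auto simp: X_def eventually_principal)
  qed
  have evE: "\<exists>J e. finite J \<and> J \<subseteq> I \<and> 0 < e \<and> (\<forall>p\<in>B J e. E p)" if "eventually E V" for E
    using that by (simp only: evV)
  have "uniform_structure_on P V"
    unfolding uniform_structure_on_def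
  proof (intro conjI allI impI)
    show "V \<le> principal (P \<times> P)"
      unfolding le_principal evV by (intro exI[of _ "{}"] exI[of _ 1]) (auto simp: B_def)
    show "\<forall>x\<in>P. E (x, x)" if "eventually E V" for E
      using that unfolding evV B_def by auto
    show "eventually (\<lambda>(x, y). E (y, x)) V" if "eventually E V" for E
    proof -
      obtain J e where J: "finite J" "J \<subseteq> I" "0 < e" "\<And>p. p \<in> B J e \<Longrightarrow> E p"
        using evE[OF \<open>eventually E V\<close>] by metis
      have "(y, x) \<in> B J e" if "(x, y) \<in> B J e" for x y
        using that by (simp add: B_def abs_minus_commute[of "ev y _"])
      then have "\<forall>p\<in>B J e. case p of (x, y) \<Rightarrow> E (y, x)"
        using J(4) by (simp add: split_beta')
      with J(1-3) show ?thesis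
        by (intro evV[THEN iffD2] exI[of _ J] exI[of _ e] conjI)
    qed
    show "\<exists>D. eventually D V \<and> (\<forall>x y z. D (x, y) \<longrightarrow> D (y, z) \<longrightarrow> E (x, z))"
      if "eventually E V" for E
    proof -
      obtain J e where J: "finite J" "J \<subseteq> I" "0 < e" "\<And>p. p \<in> B J e \<Longrightarrow> E p"
        using evE[OF \<open>eventually E V\<close>] by metis
      have "E (x, z)" if "(x, y) \<in> B J (e/2)" "(y, z) \<in> B J (e/2)" for x y z
      proof (rule J)
        have "\<bar>ev x g - ev z g\<bar> < e" if "g \<in> J" for g
        proof -
          have "\<bar>ev x g - ev y g\<bar> < e/2" "\<bar>ev y g - ev z g\<bar> < e/2"
            using \<open>(x, y) \<in> _\<close> \<open>(y, z) \<in> _\<close> that by (auto simp: B_def)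
          then show ?thesis by linarith
        qed
        then show "(x, z) \<in> B J e" using that by (auto simp: B_def)
      qed
      moreover have "eventually (\<lambda>p. p \<in> B J (e/2)) V"
        unfolding evV using J by (intro exI[of _ J] exI[of _ "e/2"]) auto
      ultimately show ?thesis by (intro exI[of _ "\<lambda>p. p \<in> B J (e/2)"]) auto
    qed
  qed
  moreover have "openin (weak_topology K) W \<longleftrightarrow>
      W \<subseteq> P \<and> (\<forall>x\<in>W. \<forall>\<^sub>F (x', y) in V. x' = x \<longrightarrow> y \<in> W)" for W
  proof
    assume o: "openin (weak_topology K) W"
    then obtain U where U: "openin ?T U" "W = ?f -` U \<inter> P"
      unfolding T openin_pullback_topology by auto
    have "\<forall>\<^sub>F (x', y) in V. x' = x \<longrightarrow> y \<in> W" if "x \<in> W" for x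
    proof -
      have "?f x \<in> U" "x \<in> P" using that U by auto
      then obtain Z where Z: "finite {i \<in> I. Z i \<noteq> UNIV}" "\<And>i. i \<in> I \<Longrightarrow> open (Z i)"
        "?f x \<in> Pi\<^sub>E I Z" "Pi\<^sub>E I Z \<subseteq> U"
        using U(1) unfolding openin_product_topology_alt by auto
      let ?J = "{i \<in> I. Z i \<noteq> UNIV}"
      have "\<exists>e>0. ball (ev x g) e \<subseteq> Z g" if "g \<in> I" for g
      proof -
        have "ev x g \<in> Z g" using Z(3) that by (auto simp: PiE_iff)
        then show ?thesis using Z(2)[OF that] open_contains_ball by blast
      qed
      then obtain \<epsilon> where \<epsilon>: "\<And>g. g \<in> I \<Longrightarrow> \<epsilon> g > 0" "\<And>g. g \<in> I \<Longrightarrow> ball (ev x g) (\<epsilon> g) \<subseteq> Z g"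
        by metis
      define e where "e = Min (insert 1 (\<epsilon> ` ?J))"
      have e: "e > 0" "\<And>g. g \<in> ?J \<Longrightarrow> e \<le> \<epsilon> g"
        using Z(1) \<epsilon>(1) by (auto simp: e_def)
      have "y \<in> W" if "(x, y) \<in> B ?J e" for y
      proof -
        have "ev y g \<in> Z g" if "g \<in> I" for g
        proof (cases "Z g = UNIV")
          case False
          then have "g \<in> ?J" using that by auto
          then have "\<bar>ev x g - ev y g\<bar> < \<epsilon> g"
            using \<open>(x, y) \<in> _\<close> e(2)[of g] by (auto simp: B_def)
          then show ?thesis using \<epsilon>(2)[OF that] by (auto simp: dist_real_def)
        qed simp
        then have "?f y \<in> Pi\<^sub>E I Z" by auto
        then have "?f y \<in> U" using Z(4) by (rule subsetD[rotated])
        moreover have "y \<in> P" using that by (auto simp: B_def)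
        ultimately show ?thesis using U(2) by simp
      qed
      then show ?thesis
        unfolding evV using Z(1) e(1) by (intro exI[of _ ?J] exI[of _ e]) auto
    qed
    then show "W \<subseteq> P \<and> (\<forall>x\<in>W. \<forall>\<^sub>F (x', y) in V. x' = x \<longrightarrow> y \<in> W)"
      using U by auto
  next
    assume *: "W \<subseteq> P \<and> (\<forall>x\<in>W. \<forall>\<^sub>F (x', y) in V. x' = x \<longrightarrow> y \<in> W)"
    then have "\<forall>x\<in>W. \<exists>J e. finite J \<and> J \<subseteq> I \<and> 0 < e \<and> (\<forall>y. (x, y) \<in> B J e \<longrightarrow> y \<in> W)"
      unfolding evV by fastforce
    then obtain J e where Je: "\<And>x. x \<in> W \<Longrightarrow> finite (J x)" "\<And>x. x \<in> W \<Longrightarrow> J x \<subseteq> I"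
      "\<And>x. x \<in> W \<Longrightarrow> 0 < e x" "\<And>x y. x \<in> W \<Longrightarrow> (x, y) \<in> B (J x) (e x) \<Longrightarrow> y \<in> W"
      by metis
    define Z where "Z x g = (if g \<in> J x then ball (ev x g) (e x) else UNIV)" for x g
    define U where "U = (\<Union>x\<in>W. Pi\<^sub>E I (Z x))"
    have "openin ?T (Pi\<^sub>E I (Z x))" if "x \<in> W" for x
      unfolding openin_PiE_gen
      using Je(1)[OF that] by (auto simp: Z_def intro: finite_subset[rotated])
    then have "openin ?T U" unfolding U_def by blast
    moreover have "W = ?f -` U \<inter> P"
    proof (intro set_eqI iffI)
      fix x assume "x \<in> W"
      then have "?f x \<in> Pi\<^sub>E I (Z x)" using Je(3) by (auto simp: Z_def)
      then show "x \<in> ?f -` U \<inter> P" using \<open>x \<in> W\<close> * by (auto simp: U_def)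
    next
      fix y assume y: "y \<in> ?f -` U \<inter> P"
      then obtain x where x: "x \<in> W" "?f y \<in> Pi\<^sub>E I (Z x)" by (auto simp: U_def)
      have "\<bar>ev x g - ev y g\<bar> < e x" if "g \<in> J x" for g
      proof -
        have "g \<in> I" using that Je(2) x by auto
        then have "ev y g \<in> Z x g" using x(2) by (auto simp: PiE_iff)
        then show ?thesis using that by (simp add: Z_def dist_real_def)
      qed
      then have "(x, y) \<in> B (J x) (e x)" using x y * by (auto simp: B_def)
      then show "y \<in> W" using Je(4) x by blast
    qed
    ultimately show "openin (weak_topology K) W"
      unfolding T openin_pullback_topology by blast
  qed
  ultimately show ?thesis unfolding uniformity_compatible_with_def top by blast
qed


section \<open>The bounded Lipschitz dual norm of a signed measure\<close>

text \<open>
  A bounded signed Borel measure is represented by its real-valued set function (only the values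
  on Borel sets matter). Its integral is the difference of the integrals with respect to the two
  parts of its Jordan decomposition.
\<close>

definition positive_part :: "('a::topological_space set \<Rightarrow> real) \<Rightarrow> 'a measure" where
  "positive_part \<sigma> =
     measure_of UNIV (sets borel) (\<lambda>A. ennreal (SUP B\<in>{B\<in>sets borel. B \<subseteq> A}. \<sigma> B))"

definition negative_part :: "('a::topological_space set \<Rightarrow> real) \<Rightarrow> 'a measure" where
  "negative_part \<sigma> = positive_part (\<lambda>A. - \<sigma> A)"

definition signed_integral :: "('a::topological_space set \<Rightarrow> real) \<Rightarrow> ('a \<Rightarrow> real) \<Rightarrow> real" where
  "signed_integral \<sigma> f = (\<integral>x. f x \<partial>positive_part \<sigma>) - (\<integral>x. f x \<partial>negative_part \<sigma>)"

definition dual_norm :: "('a::metric_space set \<Rightarrow> real) \<Rightarrow> real" where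
  "dual_norm \<sigma> =
     (SUP f\<in>{f. (\<forall>x. \<bar>f x\<bar> \<le> 1) \<and> 1-lipschitz_on UNIV f}. signed_integral \<sigma> f)"

definition measure_diff :: "'a measure \<Rightarrow> 'a measure \<Rightarrow> 'a set \<Rightarrow> real" where
  "measure_diff \<mu> \<nu> = (\<lambda>A. measure \<mu> A - measure \<nu> A)"

lemma emeasure_positive_part_diff:
  fixes \<mu> \<nu> :: "'a::topological_space measure"
  assumes fin: "finite_measure \<mu>" "finite_measure \<nu>"
    and sets: "sets \<mu> = sets borel" "sets \<nu> = sets borel"
    and Y: "Y \<in> sets borel"
    and pos: "\<And>B. B \<in> sets borel \<Longrightarrow> B \<subseteq> Y \<Longrightarrow> measure \<nu> B \<le> measure \<mu> B"
    and neg: "\<And>B. B \<in> sets borel \<Longrightarrow> B \<inter> Y = {} \<Longrightarrow> measure \<mu> B \<le> measure \<nu> B"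
    and A: "A \<in> sets borel"
  shows "emeasure (positive_part (measure_diff \<mu> \<nu>)) A = ennreal (measure_diff \<mu> \<nu> (A \<inter> Y))"
proof -
  interpret M: finite_measure \<mu> by fact
  interpret N: finite_measure \<nu> by fact
  let ?s = "measure_diff \<mu> \<nu>"
  have add: "?s (B \<union> C) = ?s B + ?s C"
    if "B \<in> sets borel" "C \<in> sets borel" "B \<inter> C = {}" for B C
    using that by (simp add: measure_diff_def M.finite_measure_Union N.finite_measure_Union sets)
  have sup: "(SUP B\<in>{B\<in>sets borel. B \<subseteq> A}. ?s B) = ?s (A \<inter> Y)" if A: "A \<in> sets borel" for A
  proof (rule cSup_eq_maximum)
    show "?s (A \<inter> Y) \<in> ?s ` {B \<in> sets borel. B \<subseteq> A}" using A Y by auto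
    fix t assume "t \<in> ?s ` {B \<in> sets borel. B \<subseteq> A}"
    then obtain B where B: "B \<in> sets borel" "B \<subseteq> A" and t: "t = ?s B" by auto
    have "?s B = ?s (B \<inter> Y) + ?s (B - Y)"
      using add[of "B \<inter> Y" "B - Y"] B Y by (simp add: Int_Diff_disjoint Int_Diff_Un)
    moreover have "?s (B - Y) \<le> 0"
      using neg[of "B - Y"] B Y by (auto simp: measure_diff_def)
    moreover have "?s (A \<inter> Y) = ?s (B \<inter> Y) + ?s ((A - B) \<inter> Y)"
    proof -
      have "A \<inter> Y = (B \<inter> Y) \<union> ((A - B) \<inter> Y)" using B by blast
      then show ?thesis using add[of "B \<inter> Y" "(A - B) \<inter> Y"] A B Y by auto
    qed
    moreover have "?s ((A - B) \<inter> Y) \<ge> 0"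
      using pos[of "(A - B) \<inter> Y"] A B Y by (auto simp: measure_diff_def)
    ultimately show "t \<le> ?s (A \<inter> Y)" using t by linarith
  qed
  show ?thesis
    unfolding positive_part_def sup[OF A, symmetric]
  proof (rule emeasure_measure_of_sigma)
    show "sigma_algebra UNIV (sets (borel :: 'a measure))"
      using sets.sigma_algebra_axioms[of "borel :: 'a measure"] by simp
    show "positive (sets borel) (\<lambda>A. ennreal (SUP B\<in>{B\<in>sets borel. B \<subseteq> A}. ?s B))"
      by (simp add: positive_def sup) (simp add: measure_diff_def)
    show "countably_additive (sets borel) (\<lambda>A. ennreal (SUP B\<in>{B\<in>sets borel. B \<subseteq> A}. ?s B))"
    proof (rule countably_additiveI)
      fix F :: "nat \<Rightarrow> 'a set"
      assume F: "range F \<subseteq> sets borel" "disjoint_family F" "(\<Union>i. F i) \<in> sets borel"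
      then have Fi: "F i \<in> sets borel" for i by auto
      have d: "disjoint_family (\<lambda>i. F i \<inter> Y)"
        using F(2) unfolding disjoint_family_on_def by blast
      have r: "range (\<lambda>i. F i \<inter> Y) \<subseteq> sets borel" using Fi Y by auto
      have "(\<lambda>i. ?s (F i \<inter> Y)) sums ?s (\<Union>i. F i \<inter> Y)"
        unfolding measure_diff_def
        using M.finite_measure_UNION[OF _ d] N.finite_measure_UNION[OF _ d] r
        by (intro sums_diff) (simp_all add: sets)
      moreover have "?s (F i \<inter> Y) \<ge> 0" for i
        using pos[of "F i \<inter> Y"] Fi[of i] Y by (auto simp: measure_diff_def)
      ultimately have "(\<Sum>i. ennreal (?s (F i \<inter> Y))) = ennreal (?s (\<Union>i. F i \<inter> Y))"
        by (intro suminf_ennreal_eq) auto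
      then show "(\<Sum>i. ennreal (SUP B\<in>{B\<in>sets borel. B \<subseteq> F i}. ?s B)) =
          ennreal (SUP B\<in>{B\<in>sets borel. B \<subseteq> (\<Union>i. F i)}. ?s B)"
        using Fi F(3) by (simp add: sup)
    qed
  qed fact
qed

lemma signed_integral_measure_diff:
  fixes \<mu> \<nu> :: "'a::topological_space measure"
  assumes fin: "finite_measure \<mu>" "finite_measure \<nu>"
    and sets: "sets \<mu> = sets borel" "sets \<nu> = sets borel"
    and f: "f \<in> borel_measurable borel" and bound: "\<And>x. \<bar>f x\<bar> \<le> c"
  shows "signed_integral (measure_diff \<mu> \<nu>) f = (\<integral>x. f x \<partial>\<mu>) - (\<integral>x. f x \<partial>\<nu>)"
proof -
  interpret M: finite_measure \<mu> by fact
  interpret N: finite_measure \<nu> by fact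
  obtain Y where Y: "Y \<in> sets \<mu>"
    and pos: "\<And>B. B \<in> sets \<mu> \<Longrightarrow> B \<subseteq> Y \<Longrightarrow> emeasure \<nu> B \<le> emeasure \<mu> B"
    and neg: "\<And>B. B \<in> sets \<mu> \<Longrightarrow> B \<inter> Y = {} \<Longrightarrow> emeasure \<mu> B \<le> emeasure \<nu> B"
    using finite_unsigned_Hahn_decomposition[OF fin] sets by auto
  have Y': "Y \<in> sets borel" using Y sets by simp
  have pos': "measure \<nu> B \<le> measure \<mu> B" if "B \<in> sets borel" "B \<subseteq> Y" for B
    using pos[of B] that by (simp add: sets M.emeasure_eq_measure N.emeasure_eq_measure)
  have neg': "measure \<mu> B \<le> measure \<nu> B" if "B \<in> sets borel" "B \<inter> Y = {}" for B
    using neg[of B] that by (simp add: sets M.emeasure_eq_measure N.emeasure_eq_measure)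
  define p where "p = positive_part (measure_diff \<mu> \<nu>)"
  define q where "q = negative_part (measure_diff \<mu> \<nu>)"
  have q: "q = positive_part (measure_diff \<nu> \<mu>)"
    by (simp add: q_def negative_part_def measure_diff_def)
  have sp: "sets p = sets borel" "sets q = sets borel"
    unfolding p_def q positive_part_def
    using sets.sigma_sets_eq[of "borel :: 'a measure"] by simp_all
  have ep: "emeasure p A = ennreal (measure_diff \<mu> \<nu> (A \<inter> Y))" if "A \<in> sets borel" for A
    unfolding p_def by (rule emeasure_positive_part_diff[OF fin sets Y' pos' neg' that])
  have eq: "emeasure q A = ennreal (measure_diff \<nu> \<mu> (A - Y))" if "A \<in> sets borel" for A
  proof -
    have "emeasure q A = ennreal (measure_diff \<nu> \<mu> (A \<inter> - Y))"
      unfolding q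
    proof (rule emeasure_positive_part_diff)
      show "- Y \<in> sets borel" using Y' by simp
      show "measure \<mu> B \<le> measure \<nu> B" if "B \<in> sets borel" "B \<subseteq> - Y" for B
        using that by (intro neg') auto
      show "measure \<nu> B \<le> measure \<mu> B" if "B \<in> sets borel" "B \<inter> - Y = {}" for B
        using that by (intro pos') auto
    qed (fact fin sets that)+
    then show ?thesis by (simp add: Diff_eq)
  qed
  interpret P: finite_measure p
    by (rule finite_measureI) (simp add: sets_eq_imp_space_eq[OF sp(1)] ep)
  interpret Q: finite_measure q
    by (rule finite_measureI) (simp add: sets_eq_imp_space_eq[OF sp(2)] eq)
  have e: "emeasure p A + emeasure \<nu> A = emeasure q A + emeasure \<mu> A"
    if A: "A \<in> sets borel" for A
  proof -
    have n1: "measure_diff \<mu> \<nu> (A \<inter> Y) \<ge> 0" and n2: "measure_diff \<nu> \<mu> (A - Y) \<ge> 0"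
      using pos'[of "A \<inter> Y"] neg'[of "A - Y"] A Y' by (auto simp: measure_diff_def)
    have "measure \<mu> A = measure \<mu> (A \<inter> Y) + measure \<mu> (A - Y)"
      using M.finite_measure_Union[of "A \<inter> Y" "A - Y"] A Y'
      by (simp add: sets Int_Diff_disjoint Int_Diff_Un)
    moreover have "measure \<nu> A = measure \<nu> (A \<inter> Y) + measure \<nu> (A - Y)"
      using N.finite_measure_Union[of "A \<inter> Y" "A - Y"] A Y'
      by (simp add: sets Int_Diff_disjoint Int_Diff_Un)
    ultimately have "measure_diff \<mu> \<nu> (A \<inter> Y) + measure \<nu> A =
        measure_diff \<nu> \<mu> (A - Y) + measure \<mu> A"
      by (simp add: measure_diff_def)
    then show ?thesis
      using n1 n2 A
      by (simp add: ep eq M.emeasure_eq_measure N.emeasure_eq_measure flip: ennreal_plus)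
  qed
  have mc: "(borel_measurable p :: ('a \<Rightarrow> ennreal) set) = borel_measurable borel"
    "(borel_measurable q :: ('a \<Rightarrow> ennreal) set) = borel_measurable borel"
    "(borel_measurable \<mu> :: ('a \<Rightarrow> ennreal) set) = borel_measurable borel"
    "(borel_measurable \<nu> :: ('a \<Rightarrow> ennreal) set) = borel_measurable borel"
    by (intro measurable_cong_sets sp sets refl)+
  have nn: "(\<integral>\<^sup>+x. h x \<partial>p) + (\<integral>\<^sup>+x. h x \<partial>\<nu>) = (\<integral>\<^sup>+x. h x \<partial>q) + (\<integral>\<^sup>+x. h x \<partial>\<mu>)"
    if "h \<in> borel_measurable borel" for h :: "'a \<Rightarrow> ennreal"
    using that
  proof (induction rule: borel_measurable_induct)
    case (cong f g)
    then show ?case by (simp add: space_borel fun_eq_iff[symmetric])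
  next
    case (set A)
    then show ?case using e[of A] by (simp add: sp sets)
  next
    case (mult u c)
    then have "u \<in> borel_measurable p" "u \<in> borel_measurable q"
      "u \<in> borel_measurable \<mu>" "u \<in> borel_measurable \<nu>"
      by (simp_all add: mc)
    then show ?case using mult by (simp add: nn_integral_cmult flip: distrib_left)
  next
    case (add u v)
    then have "w \<in> borel_measurable p" "w \<in> borel_measurable q"
      "w \<in> borel_measurable \<mu>" "w \<in> borel_measurable \<nu>" if "w \<in> {u, v}" for w
      using that by (auto simp: mc)
    then show ?case using add by (simp add: nn_integral_add) (metis add.assoc add.left_commute)
  next
    case (seq F)
    have m: "F i \<in> borel_measurable p" "F i \<in> borel_measurable q"
      "F i \<in> borel_measurable \<mu>" "F i \<in> borel_measurable \<nu>" for i
      using seq by (simp_all add: mc)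
    have inc: "incseq (\<lambda>i. \<integral>\<^sup>+x. F i x \<partial>K)" for K
      using seq(3) by (auto simp: incseq_def le_fun_def intro!: nn_integral_mono)
    have "(SUP i. \<integral>\<^sup>+x. F i x \<partial>p) + (SUP i. \<integral>\<^sup>+x. F i x \<partial>\<nu>) =
        (SUP i. \<integral>\<^sup>+x. F i x \<partial>q) + (SUP i. \<integral>\<^sup>+x. F i x \<partial>\<mu>)"
      using seq by (simp add: inc flip: ennreal_SUP_add)
    then show ?case
      using m seq by (simp add: nn_integral_monotone_convergence_SUP image_comp)
  qed
  have c0: "0 \<le> f x + c" for x using bound[of x] by linarith
  have fm: "f \<in> borel_measurable p" "f \<in> borel_measurable q"
    "f \<in> borel_measurable \<mu>" "f \<in> borel_measurable \<nu>"
    using f measurable_cong_sets[OF _ refl, of _ borel] sp sets by blast+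
  have int: "integrable p f" "integrable q f" "integrable \<mu> f" "integrable \<nu> f"
    by (intro P.integrable_const_bound[where B=c] Q.integrable_const_bound[where B=c]
        M.integrable_const_bound[where B=c] N.integrable_const_bound[where B=c];
        simp add: bound fm)+
  have I: "(\<integral>\<^sup>+x. ennreal (f x + c) \<partial>K) = ennreal ((\<integral>x. f x \<partial>K) + c * measure K (space K))"
    and I0: "(\<integral>x. f x \<partial>K) + c * measure K (space K) \<ge> 0"
    if "integrable K f" "finite_measure K" for K
  proof -
    interpret K: finite_measure K by fact
    have "(\<integral>\<^sup>+x. ennreal (f x + c) \<partial>K) = ennreal (\<integral>x. f x + c \<partial>K)"
      using that(1) c0 by (intro nn_integral_eq_integral) auto
    moreover have eqn: "(\<integral>x. f x + c \<partial>K) = (\<integral>x. f x \<partial>K) + c * measure K (space K)"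
      using that(1) by simp
    ultimately show "(\<integral>\<^sup>+x. ennreal (f x + c) \<partial>K) = ennreal ((\<integral>x. f x \<partial>K) + c * measure K (space K))"
      by simp
    have "(\<integral>x. f x + c \<partial>K) \<ge> 0" using c0 by (intro integral_nonneg_AE) auto
    then show "(\<integral>x. f x \<partial>K) + c * measure K (space K) \<ge> 0" using eqn by simp
  qed
  have "(\<lambda>x. ennreal (f x + c)) \<in> borel_measurable borel" using f by simp
  from nn[OF this] have "ennreal (((\<integral>x. f x \<partial>p) + c * measure p (space p)) +
        ((\<integral>x. f x \<partial>\<nu>) + c * measure \<nu> (space \<nu>))) =
      ennreal (((\<integral>x. f x \<partial>q) + c * measure q (space q)) +
        ((\<integral>x. f x \<partial>\<mu>) + c * measure \<mu> (space \<mu>)))"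
    using int P.finite_measure_axioms Q.finite_measure_axioms fin
    by (simp add: I I0 ennreal_plus)
  then have "((\<integral>x. f x \<partial>p) + c * measure p (space p)) +
        ((\<integral>x. f x \<partial>\<nu>) + c * measure \<nu> (space \<nu>)) =
      ((\<integral>x. f x \<partial>q) + c * measure q (space q)) +
        ((\<integral>x. f x \<partial>\<mu>) + c * measure \<mu> (space \<mu>))"
    using int P.finite_measure_axioms Q.finite_measure_axioms fin
    by (subst (asm) ennreal_inj) (auto intro!: add_nonneg_nonneg I0)
  moreover have "measure p (space p) + measure \<nu> (space \<nu>) =
      measure q (space q) + measure \<mu> (space \<mu>)"
    using e[of UNIV] sp[THEN sets_eq_imp_space_eq] sets[THEN sets_eq_imp_space_eq]
    by (simp add: P.emeasure_eq_measure Q.emeasure_eq_measure M.emeasure_eq_measure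
        N.emeasure_eq_measure flip: ennreal_plus)
  then have "c * measure p (space p) + c * measure \<nu> (space \<nu>) =
      c * measure q (space q) + c * measure \<mu> (space \<mu>)"
    by (metis distrib_left)
  ultimately show ?thesis
    unfolding signed_integral_def p_def[symmetric] q_def[symmetric] by linarith
qed


section \<open>Almost surely asymptotic random variables and the two properties\<close>

definition as_asymptotic_representation ::
    "'w measure \<Rightarrow> (nat \<Rightarrow> 'w \<Rightarrow> 'a::metric_space) \<Rightarrow> (nat \<Rightarrow> 'w \<Rightarrow> 'a) \<Rightarrow>
     (nat \<Rightarrow> 'a measure) \<Rightarrow> (nat \<Rightarrow> 'a measure) \<Rightarrow> bool" where
  "as_asymptotic_representation \<Omega> X Y \<mu> \<nu> \<longleftrightarrow>
     prob_space \<Omega> \<and>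
     (\<forall>j. X j \<in> borel_measurable \<Omega> \<and> distr \<Omega> borel (X j) = \<mu> j) \<and>
     (\<forall>j. Y j \<in> borel_measurable \<Omega> \<and> distr \<Omega> borel (Y j) = \<nu> j) \<and>
     (AE \<omega> in \<Omega>. (\<lambda>j. dist (X j \<omega>) (Y j \<omega>)) \<longlonglongrightarrow> 0)"

text \<open>
  A formula cannot quantify over the type of the sample space. Sample spaces of type
  \<open>nat \<Rightarrow> 'a \<times> 'a\<close>, with an arbitrary \<open>\<sigma>\<close>-algebra and an arbitrary probability measure, are used
  throughout; by the following lemma this loses no generality.
\<close>

lemma as_asymptotic_representation_sequence_space:
  fixes \<Omega> :: "'w measure" and \<mu> \<nu> :: "nat \<Rightarrow> 'a::metric_space measure"
  assumes "as_asymptotic_representation \<Omega> X Y \<mu> \<nu>"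
  shows "\<exists>(\<Omega>' :: (nat \<Rightarrow> 'a \<times> 'a) measure) X' Y'. as_asymptotic_representation \<Omega>' X' Y' \<mu> \<nu>"
proof -
  have P: "prob_space \<Omega>"
    and X: "X j \<in> borel_measurable \<Omega>" "distr \<Omega> borel (X j) = \<mu> j"
    and Y: "Y j \<in> borel_measurable \<Omega>" "distr \<Omega> borel (Y j) = \<nu> j"
    and AE: "AE \<omega> in \<Omega>. (\<lambda>j. dist (X j \<omega>) (Y j \<omega>)) \<longlonglongrightarrow> 0" for j
    using assms unfolding as_asymptotic_representation_def by auto
  define C where "C = completion \<Omega>"
  have PC: "prob_space C"
    unfolding C_def using P by (rule prob_space.prob_space_completion)
  have XC: "X j \<in> borel_measurable C" "distr C borel (X j) = \<mu> j"
    and YC: "Y j \<in> borel_measurable C" "distr C borel (Y j) = \<nu> j" for j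
    using X Y by (auto simp: C_def distr_completion measurable_completion)
  define \<Phi> where "\<Phi> \<omega> = (\<lambda>j. (X j \<omega>, Y j \<omega>))" for \<omega>
  define G where "G = {A. \<Phi> -` A \<inter> space C \<in> sets C}"
  define \<Sigma> where "\<Sigma> = sigma UNIV G"
  have GS: "A \<in> sets \<Sigma>" if "A \<in> G" for A
    using that by (simp add: \<Sigma>_def)
  have sp: "space \<Sigma> = UNIV" by (simp add: \<Sigma>_def)
  have \<Phi>: "\<Phi> \<in> measurable C \<Sigma>"
    unfolding \<Sigma>_def by (rule measurable_measure_of) (auto simp: G_def)
  define X' where "X' j s = fst (s j)" for j and s :: "nat \<Rightarrow> 'a \<times> 'a"
  define Y' where "Y' j s = snd (s j)" for j and s :: "nat \<Rightarrow> 'a \<times> 'a"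
  have cX: "X' j \<circ> \<Phi> = X j" and cY: "Y' j \<circ> \<Phi> = Y j" for j
    by (auto simp: X'_def Y'_def \<Phi>_def)
  have X': "X' j \<in> borel_measurable \<Sigma>" for j
  proof (rule measurableI)
    fix B :: "'a set" assume "B \<in> sets borel"
    then have "X j -` B \<inter> space C \<in> sets C" using XC(1) by (rule measurable_sets[rotated])
    moreover have "\<Phi> -` (X' j -` B) = X j -` B" by (auto simp: X'_def \<Phi>_def)
    ultimately show "X' j -` B \<inter> space \<Sigma> \<in> sets \<Sigma>" by (intro GS) (simp add: G_def sp)
  qed simp
  have Y': "Y' j \<in> borel_measurable \<Sigma>" for j
  proof (rule measurableI)
    fix B :: "'a set" assume "B \<in> sets borel"
    then have "Y j -` B \<inter> space C \<in> sets C" using YC(1) by (rule measurable_sets[rotated])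
    moreover have "\<Phi> -` (Y' j -` B) = Y j -` B" by (auto simp: Y'_def \<Phi>_def)
    ultimately show "Y' j -` B \<inter> space \<Sigma> \<in> sets \<Sigma>" by (intro GS) (simp add: G_def sp)
  qed simp
  let ?L = "{s. (\<lambda>j. dist (X' j s) (Y' j s)) \<longlonglongrightarrow> 0}"
  have AEC: "AE \<omega> in C. (\<lambda>j. dist (X j \<omega>) (Y j \<omega>)) \<longlonglongrightarrow> 0"
    unfolding C_def using AE by (rule AE_completion)
  have "{\<omega> \<in> space C. \<not> (\<lambda>j. dist (X j \<omega>) (Y j \<omega>)) \<longlonglongrightarrow> 0} \<in> sets C"
  proof -
    obtain N where "{\<omega> \<in> space \<Omega>. \<not> (\<lambda>j. dist (X j \<omega>) (Y j \<omega>)) \<longlonglongrightarrow> 0} \<subseteq> N"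
      "N \<in> null_sets \<Omega>"
      using AE by (auto elim!: AE_E3 simp: eventually_ae_filter)
    then have "{\<omega> \<in> space \<Omega>. \<not> (\<lambda>j. dist (X j \<omega>) (Y j \<omega>)) \<longlonglongrightarrow> 0} \<in> null_sets (completion \<Omega>)"
      by (intro null_sets_completion_subset[OF _ null_sets_completionI])
    then show ?thesis by (simp add: C_def null_sets_def)
  qed
  then have "space C - {\<omega> \<in> space C. \<not> (\<lambda>j. dist (X j \<omega>) (Y j \<omega>)) \<longlonglongrightarrow> 0} \<in> sets C"
    by (rule sets.compl_sets)
  moreover have "space C - {\<omega> \<in> space C. \<not> (\<lambda>j. dist (X j \<omega>) (Y j \<omega>)) \<longlonglongrightarrow> 0}
      = \<Phi> -` ?L \<inter> space C"
    by (auto simp: X'_def Y'_def \<Phi>_def)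
  ultimately have L: "?L \<in> sets \<Sigma>" by (intro GS) (simp add: G_def)
  define \<Omega>' where "\<Omega>' = distr C \<Sigma> \<Phi>"
  have "prob_space \<Omega>'"
    unfolding \<Omega>'_def using PC \<Phi> by (rule prob_space.prob_space_distr)
  moreover have "distr \<Omega>' borel (X' j) = \<mu> j" "distr \<Omega>' borel (Y' j) = \<nu> j" for j
    unfolding \<Omega>'_def using X' Y' \<Phi> XC YC by (simp_all add: distr_distr cX cY)
  moreover have "X' j \<in> borel_measurable \<Omega>'" "Y' j \<in> borel_measurable \<Omega>'" for j
    using X' Y' by (simp_all add: \<Omega>'_def)
  moreover have "AE s in \<Omega>'. (\<lambda>j. dist (X' j s) (Y' j s)) \<longlonglongrightarrow> 0"
    unfolding \<Omega>'_def using L AEC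
    by (subst AE_distr_iff[OF \<Phi>]) (simp_all add: sp X'_def Y'_def \<Phi>_def)
  ultimately show ?thesis
    unfolding as_asymptotic_representation_def by blast
qed

definition property_A1 :: "('a::metric_space measure \<times> 'a measure) filter \<Rightarrow> bool" where
  "property_A1 U \<longleftrightarrow>
     (\<forall>(\<Omega> :: (nat \<Rightarrow> 'a \<times> 'a) measure) X Y \<mu> \<nu>.
        (\<forall>j. \<mu> j \<in> tight_prob_measures UNIV) \<longrightarrow>
        (\<forall>j. \<nu> j \<in> tight_prob_measures UNIV) \<longrightarrow>
        as_asymptotic_representation \<Omega> X Y \<mu> \<nu> \<longrightarrow>
        asymptotic_approximation (tight_prob_measures UNIV) U sequentially \<mu> \<nu>)"

text \<open>
  The interval \<open>[-n, n]\<close> is the metric space \<^term>\<open>{- real n .. real n}\<close>. The uniformity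
  compatible with the (compact) weak topology is unique, so \<open>V\<close> ranges over exactly one value.
\<close>

definition property_A2 :: "('a::metric_space measure \<times> 'a measure) filter \<Rightarrow> bool" where
  "property_A2 U \<longleftrightarrow>
     (\<forall>n::nat. \<forall>\<phi> :: 'a \<Rightarrow> real. 1 \<le> n \<longrightarrow>
        range \<phi> \<subseteq> {- real n .. real n} \<longrightarrow> uniformly_continuous_on UNIV \<phi> \<longrightarrow>
        (\<forall>V. uniformity_compatible_with (weak_topology {- real n .. real n}) V \<longrightarrow>
           uniformly_continuous_wrt U V
             (\<lambda>\<mu>. distr \<mu> (restrict_space borel {- real n .. real n}) \<phi>)))"

end

theory Submission
  imports Defs
begin

text \<open>
  The implications are proved in the cycle (i), (iii), (iv), (ii), (i). From (i) to (iii) the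
  argument is a gliding hump: uniformly separated Lipschitz humps, one for each bad index, add up to
  a single bounded uniformly continuous function on which \<open>\<mu> j - \<nu> j\<close> does not tend to \<open>0\<close>.

  From (iii) to (iv), a small dual norm gives \<open>\<mu>(A) \<le> \<nu>(A\<^sup>\<epsilon>) + \<epsilon>\<close> for all unions \<open>A\<close> of small Borel
  blocks covering a compact set of almost full measure, where \<open>A\<^sup>\<epsilon>\<close> is the \<open>\<epsilon>\<close>-neighbourhood.
  A weighted marriage theorem turns these inequalities into a transport plan between the blocks, and
  the plan into a decomposition of a coupling into a good part, on which the distance is at most
  \<open>5 * \<epsilon>\<close>, and a bad part of mass at most \<open>3 * \<epsilon>\<close>. The couplings for all indices are then realised
  with one common uniform variable deciding between good and bad.

  (iv) gives (ii) by (A1). From (ii) to (i), write an integral of \<open>f\<close> as the integral of the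
  identity against the image measure on an interval, and apply (A2).
\<close>

section \<open>Uniformities that make the integral of the identity uniformly continuous\<close>

text \<open>Compact subsets of the space come only from tightness, always at the price of a little
  mass. This shapes both hard steps. Lipschitz functions are totally bounded only on compact sets,
  while the bad indices may keep moving mass elsewhere; so each hump is confined to the vicinity of
  a compact carrier of its own index, and later humps avoid that carrier. For the couplings, no
  index needs an optimal one: an error of order \<epsilon> in distance and in mass is enough as long
  as \<epsilon> tends to 0 along the sequence. Hence finitely many blocks suffice for each pair of
  measures, and no limit of couplings is taken. The masses \<open>q j\<close> of the bad parts need
  not be summable, so choosing independently between good and bad would give only convergence in
  probability. With one uniform variable \<open>T\<close> the bad events are
  \<open>T \<le> q j\<close>, and for \<open>T > 0\<close> only finitely many of them occur.\<close>

text \<open>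
  Property (A2) quantifies over every uniformity compatible with the weak topology. Refining one by
  a continuous function keeps it compatible, so the uniqueness of the compatible uniformity on a
  compact space is not needed.
\<close>

lemma eventually_inf_filtercomap_uniformity:
  fixes h :: "'p \<Rightarrow> real"
  shows "eventually E (inf V (filtercomap (\<lambda>(x, y). (h x, h y)) uniformity)) \<longleftrightarrow>
    (\<exists>P e. eventually P V \<and> 0 < e \<and> (\<forall>x y. P (x, y) \<longrightarrow> dist (h x) (h y) < e \<longrightarrow> E (x, y)))"
  (is "?l \<longleftrightarrow> ?r")
proof
  assume ?l
  then obtain P Q where PQ: "eventually P V"
      "eventually Q (filtercomap (\<lambda>(x, y). (h x, h y)) uniformity)" "\<And>x. P x \<Longrightarrow> Q x \<Longrightarrow> E x"
    unfolding eventually_inf by auto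
  then obtain e where "0 < e" "\<And>x y. dist (h x) (h y) < e \<Longrightarrow> Q (x, y)"
    unfolding eventually_filtercomap eventually_uniformity_metric by (metis case_prod_conv)
  with PQ show ?r by blast
next
  assume ?r
  then obtain P e where P: "eventually P V" "0 < e"
      "\<forall>x y. P (x, y) \<longrightarrow> dist (h x) (h y) < e \<longrightarrow> E (x, y)" by blast
  then have "eventually (\<lambda>(x, y). dist (h x) (h y) < e) (filtercomap (\<lambda>(x, y). (h x, h y)) uniformity)"
    unfolding eventually_filtercomap eventually_uniformity_metric
    by (intro exI[of _ "\<lambda>(x, y). dist x y < e"]) auto
  with P show ?l
    unfolding eventually_inf by (intro exI[of _ P] exI[of _ "\<lambda>(x, y). dist (h x) (h y) < e"]) auto
qed

text \<open>The refinement adds no open sets: by continuity of \<open>h\<close> the strip of points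
  with \<open>h\<close>-value near \<open>h x\<close> is already open in \<open>T\<close>, hence
  already a \<open>V\<close>-neighbourhood of \<open>x\<close>.\<close>

lemma uniformity_compatible_with_inf_filtercomap:
  fixes h :: "'p \<Rightarrow> real"
  assumes V: "uniformity_compatible_with T V" and h: "continuous_map T euclideanreal h"
  shows "uniformity_compatible_with T (inf V (filtercomap (\<lambda>(x, y). (h x, h y)) uniformity))"
    (is "uniformity_compatible_with T ?V'")
proof -
  let ?A = "topspace T"
  have us: "uniform_structure_on ?A V"
    and op: "\<And>W. openin T W \<longleftrightarrow> W \<subseteq> ?A \<and> (\<forall>x\<in>W. \<forall>\<^sub>F (x', y) in V. x' = x \<longrightarrow> y \<in> W)"
    using V by (auto simp: uniformity_compatible_with_def)
  have us1: "V \<le> principal (?A \<times> ?A)"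
    and us2: "\<And>E x. eventually E V \<Longrightarrow> x \<in> ?A \<Longrightarrow> E (x, x)"
    and us3: "\<And>E. eventually E V \<Longrightarrow> eventually (\<lambda>(x, y). E (y, x)) V"
    and us4: "\<And>E. eventually E V \<Longrightarrow>
      \<exists>D. eventually D V \<and> (\<forall>x y z. D (x, y) \<longrightarrow> D (y, z) \<longrightarrow> E (x, z))"
    using us unfolding uniform_structure_on_def by blast+
  have "uniform_structure_on ?A ?V'"
    unfolding uniform_structure_on_def
  proof (intro conjI allI impI)
    show "?V' \<le> principal (?A \<times> ?A)" using us1 by (rule le_infI1)
    fix E assume "eventually E ?V'"
    then obtain P e where P: "eventually P V" "0 < e"
      and E: "\<And>x y. P (x, y) \<Longrightarrow> dist (h x) (h y) < e \<Longrightarrow> E (x, y)"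
      unfolding eventually_inf_filtercomap_uniformity by blast
    show "\<forall>x\<in>?A. E (x, x)" using us2[OF P(1)] E P(2) by simp
    have "eventually (\<lambda>(x, y). P (y, x)) V" using us3 P by blast
    with P E show "eventually (\<lambda>(x, y). E (y, x)) ?V'"
      unfolding eventually_inf_filtercomap_uniformity
      by (intro exI[of _ "\<lambda>(x, y). P (y, x)"] exI[of _ e]) (auto simp: dist_commute)
    obtain D where D: "eventually D V" "\<And>x y z. D (x, y) \<Longrightarrow> D (y, z) \<Longrightarrow> P (x, z)"
      using us4[OF P(1)] by blast
    let ?D = "\<lambda>(x, y). D (x, y) \<and> dist (h x) (h y) < e / 2"
    have "eventually ?D ?V'"
      unfolding eventually_inf_filtercomap_uniformity
      using D(1) P(2) by (intro exI[of _ D] exI[of _ "e / 2"]) auto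
    moreover have "E (x, z)" if "?D (x, y)" "?D (y, z)" for x y z
      using that D(2) dist_triangle_half_r[of "h y" "h x" e "h z"]
      by (intro E) (auto simp: dist_commute)
    ultimately show "\<exists>D. eventually D ?V' \<and> (\<forall>x y z. D (x, y) \<longrightarrow> D (y, z) \<longrightarrow> E (x, z))"
      by blast
  qed
  moreover have "openin T W \<longleftrightarrow> W \<subseteq> ?A \<and> (\<forall>x\<in>W. \<forall>\<^sub>F (x', y) in ?V'. x' = x \<longrightarrow> y \<in> W)" for W
  proof
    assume "openin T W"
    then show "W \<subseteq> ?A \<and> (\<forall>x\<in>W. \<forall>\<^sub>F (x', y) in ?V'. x' = x \<longrightarrow> y \<in> W)"
      unfolding op by (auto intro: filter_leD[OF inf.cobounded1])
  next
    assume W: "W \<subseteq> ?A \<and> (\<forall>x\<in>W. \<forall>\<^sub>F (x', y) in ?V'. x' = x \<longrightarrow> y \<in> W)"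
    have "\<forall>\<^sub>F (x', y) in V. x' = x \<longrightarrow> y \<in> W" if x: "x \<in> W" for x
    proof -
      obtain P e where P: "eventually P V" "0 < e"
        and PW: "\<And>y. P (x, y) \<Longrightarrow> dist (h x) (h y) < e \<Longrightarrow> y \<in> W"
        using W[THEN conjunct2, rule_format, OF x]
        unfolding eventually_inf_filtercomap_uniformity by auto
      have "openin T {y \<in> ?A. h y \<in> ball (h x) e}"
        using h by (rule openin_continuous_map_preimage) simp
      moreover have "x \<in> {y \<in> ?A. h y \<in> ball (h x) e}"
        using x W P(2) by auto
      ultimately have "\<forall>\<^sub>F (x', y) in V. x' = x \<longrightarrow> y \<in> {y \<in> ?A. h y \<in> ball (h x) e}"
        unfolding op by blast
      with P(1) show ?thesis
        by eventually_elim (auto intro: PW)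
    qed
    with W show "openin T W" unfolding op by blast
  qed
  ultimately show ?thesis unfolding uniformity_compatible_with_def by blast
qed

section \<open>Integrals as uniformly continuous functions of the measure\<close>

lemma continuous_map_weak_topology_integral:
  assumes "g \<in> bounded_continuous_on K"
  shows "continuous_map (weak_topology K) euclideanreal (\<lambda>\<mu>. \<integral>x. g x \<partial>\<mu>)"
proof -
  have "continuous_map (product_topology (\<lambda>_. euclideanreal) (bounded_continuous_on K))
      euclideanreal (\<lambda>u. u g)"
    using assms by (rule continuous_map_product_projection)
  from continuous_map_pullback[OF this]
  have "continuous_map (weak_topology K) euclideanreal
      ((\<lambda>u. u g) \<circ> (\<lambda>\<mu>. \<lambda>g\<in>bounded_continuous_on K. \<integral>x. g x \<partial>\<mu>))"
    unfolding weak_topology_def .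
  then show ?thesis using assms by (simp add: o_def)
qed

text \<open>Makes \<open>\<bar>H x - H y\<bar>\<close> an admissible test pseudometric in
  \<open>asymptotic_approximation\<close>.\<close>

lemma uniformly_continuous_wrt_abs_diff:
  fixes H :: "'p \<Rightarrow> real"
  assumes "uniformly_continuous_wrt U uniformity H"
  shows "uniformly_continuous_wrt (prod_uniformity U U) uniformity (\<lambda>(x, y). \<bar>H x - H y\<bar>)"
  unfolding uniformly_continuous_wrt_def filterlim_iff
proof (intro allI impI)
  fix E :: "real \<times> real \<Rightarrow> bool" assume "eventually E uniformity"
  then obtain e where e: "0 < e" "\<And>s t. dist s t < e \<Longrightarrow> E (s, t)"
    unfolding eventually_uniformity_metric by blast
  let ?P = "\<lambda>(x, y). \<bar>H x - H y\<bar> < e / 2"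
  have "eventually (\<lambda>(s, t). dist s t < e / 2) (uniformity :: (real \<times> real) filter)"
    unfolding eventually_uniformity_metric using e(1) by (intro exI[of _ "e/2"]) auto
  from eventually_compose_filterlim[OF this assms[unfolded uniformly_continuous_wrt_def]]
  have "eventually ?P U"
    by (simp add: dist_real_def split_beta')
  moreover have "E (\<bar>H x - H y\<bar>, \<bar>H x' - H y'\<bar>)" if "?P (x, x')" "?P (y, y')" for x y x' y'
    using that unfolding case_prod_conv by (intro e(2)) (unfold dist_real_def, linarith)
  ultimately show "\<forall>\<^sub>F p in prod_uniformity U U.
      E (case p of (x, y) \<Rightarrow> ((case x of (x, y) \<Rightarrow> \<bar>H x - H y\<bar>), case y of (x, y) \<Rightarrow> \<bar>H x - H y\<bar>))"
    unfolding prod_uniformity_def eventually_filtermap eventually_prod_filter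
    by (intro exI[of _ ?P]) auto
qed

lemma asymptotic_approximation_abs_diff:
  fixes H :: "'p \<Rightarrow> real"
  assumes "asymptotic_approximation A U F a b" "uniformly_continuous_wrt U uniformity H"
  shows "((\<lambda>\<gamma>. H (a \<gamma>) - H (b \<gamma>)) \<longlongrightarrow> 0) F"
proof -
  have "pseudometric_on A (\<lambda>x y. \<bar>H x - H y\<bar>)"
    by (auto simp: pseudometric_on_def)
  moreover note uniformly_continuous_wrt_abs_diff[OF assms(2)]
  ultimately have "((\<lambda>\<gamma>. \<bar>H (a \<gamma>) - H (b \<gamma>)\<bar>) \<longlongrightarrow> 0) F"
    using assms(1)[unfolded asymptotic_approximation_def, rule_format, of "\<lambda>x y. \<bar>H x - H y\<bar>"]
    by blast
  then show ?thesis by (rule tendsto_rabs_zero_cancel)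
qed

lemma asymptotic_approximation_imp_integral_diff:
  fixes U :: "('a::metric_space measure \<times> 'a measure) filter"
  assumes "property_A2 U"
    and app: "asymptotic_approximation (tight_prob_measures UNIV) U sequentially \<mu> \<nu>"
    and \<mu>: "\<And>j. \<mu> j \<in> tight_prob_measures UNIV"
    and \<nu>: "\<And>j. \<nu> j \<in> tight_prob_measures UNIV"
    and f: "f \<in> bounded_uniformly_continuous_on UNIV"
  shows "(\<lambda>j. (\<integral>x. f x \<partial>\<mu> j) - (\<integral>x. f x \<partial>\<nu> j)) \<longlonglongrightarrow> 0"
proof -
  have uc: "uniformly_continuous_on UNIV f" and "bounded (range f)"
    using f by (auto simp: bounded_uniformly_continuous_on_def)
  then obtain B where B: "\<And>x. \<bar>f x\<bar> \<le> B" by (auto simp: bounded_iff)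
  \<comment> \<open>The interval must contain the range of \<open>f\<close>, and (A2) speaks only of
    \<open>n \<ge> 1\<close>.\<close>
  obtain n where n: "max 1 B \<le> real n" using real_arch_simple by blast
  define K where "K = {- real n .. real n}"
  have "f x \<in> K" for x using B[of x] n by (simp add: K_def abs_le_iff)
  then have fK: "range f \<subseteq> K" by blast
  obtain V where V: "uniformity_compatible_with (weak_topology K) V"
    using ex_uniformity_compatible_with_weak_topology by blast
  define h where "h \<rho> = (\<integral>x. x \<partial>\<rho>)" for \<rho> :: "real measure"
  have "(\<lambda>x. x) \<in> bounded_continuous_on K"
    by (auto simp: bounded_continuous_on_def K_def)
  then have "continuous_map (weak_topology K) euclideanreal h"
    unfolding h_def by (rule continuous_map_weak_topology_integral)
  with V have V': "uniformity_compatible_with (weak_topology K)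
      (inf V (filtercomap (\<lambda>(x, y). (h x, h y)) uniformity))"
    by (rule uniformity_compatible_with_inf_filtercomap)
  define \<phi> where "\<phi> \<rho> = distr \<rho> (restrict_space borel K) f" for \<rho>
  have "1 \<le> n" using n by simp
  then have "uniformly_continuous_wrt U (inf V (filtercomap (\<lambda>(x, y). (h x, h y)) uniformity)) \<phi>"
    using assms(1) fK uc V' unfolding property_A2_def K_def \<phi>_def by blast
  \<comment> \<open>The pullback along \<open>h\<close> is a component of the target uniformity, so
    uniform continuity of \<open>h\<close> is built in.\<close>
  then have "uniformly_continuous_wrt U uniformity (h \<circ> \<phi>)"
    unfolding uniformly_continuous_wrt_def filterlim_inf filterlim_filtercomap_iff
    by (simp add: o_def split_beta')
  from asymptotic_approximation_abs_diff[OF app this]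
  have "(\<lambda>j. h (\<phi> (\<mu> j)) - h (\<phi> (\<nu> j))) \<longlonglongrightarrow> 0" by simp
  moreover have "h (\<phi> \<rho>) = (\<integral>x. f x \<partial>\<rho>)" if "\<rho> \<in> tight_prob_measures UNIV" for \<rho>
  proof -
    have "sets \<rho> = sets borel" using that by (simp add: tight_prob_measures_def)
    moreover have "f \<in> borel_measurable borel"
      using uc by (intro borel_measurable_continuous_onI uniformly_continuous_imp_continuous)
    ultimately have "f \<in> measurable \<rho> (restrict_space borel K)"
      using fK measurable_cong_sets[of \<rho> borel borel borel] by (intro measurable_restrict_space2) auto
    then show ?thesis
      unfolding h_def \<phi>_def by (intro integral_distr) (auto intro: measurable_restrict_space1)
  qed
  ultimately show ?thesis using \<mu> \<nu> by simp
qed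

section \<open>Convergence in the dual norm\<close>

lemma tight_prob_measuresD:
  assumes "\<mu> \<in> tight_prob_measures (UNIV :: 'a::metric_space set)"
  shows "prob_space \<mu>" "sets \<mu> = sets borel" "space \<mu> = UNIV"
proof -
  show "prob_space \<mu>" "sets \<mu> = sets borel"
    using assms by (auto simp: tight_prob_measures_def)
  then show "space \<mu> = UNIV" using sets_eq_imp_space_eq[of \<mu> borel] by simp
qed

section \<open>Compact carriers, integral estimates and the dual norm as a supremum\<close>

lemma tight_prob_measures_compact:
  fixes \<mu> :: "'a::metric_space measure"
  assumes \<mu>: "\<mu> \<in> tight_prob_measures UNIV" and \<delta>: "0 < \<delta>"
  obtains C where "compact C" "1 - \<delta> < measure \<mu> C"
proof -
  interpret prob_space \<mu> using \<mu> by (rule tight_prob_measuresD)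
  have "UNIV \<in> sets \<mu>" using sets.top[of \<mu>] by (simp add: tight_prob_measuresD[OF \<mu>])
  then have "emeasure \<mu> UNIV = (SUP C\<in>{C. compact C \<and> C \<subseteq> UNIV}. emeasure \<mu> C)"
    using \<mu> by (simp add: tight_prob_measures_def)
  moreover have "emeasure \<mu> UNIV = 1"
    using emeasure_space_1 by (simp add: tight_prob_measuresD[OF \<mu>])
  moreover have "ennreal (1 - \<delta>) < 1" using \<delta> by (simp add: ennreal_less_one_iff)
  ultimately obtain C where "compact C" "ennreal (1 - \<delta>) < emeasure \<mu> C"
    by (metis (no_types, lifting) less_SUP_iff mem_Collect_eq)
  moreover from this have "1 - \<delta> < measure \<mu> C"
    using ennreal_leI[of "measure \<mu> C" "1 - \<delta>"] by (metis emeasure_eq_measure linorder_not_less)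
  ultimately show thesis by (intro that)
qed

lemma integrable_bounded_borel:
  fixes f :: "'a::topological_space \<Rightarrow> real"
  assumes "finite_measure M" "sets M = sets borel" "f \<in> borel_measurable borel" "\<And>x. \<bar>f x\<bar> \<le> c"
  shows "integrable M f"
proof -
  interpret finite_measure M by fact
  show ?thesis
    using assms by (intro integrable_const_bound[of _ c]) (auto cong: measurable_cong_sets)
qed

lemma abs_integral_diff_le:
  fixes f g :: "'a \<Rightarrow> real"
  assumes "prob_space M" and int: "integrable M f" "integrable M g"
    and A: "A \<in> sets M" "1 - measure M A \<le> \<eta>"
    and on: "\<And>x. x \<in> A \<Longrightarrow> \<bar>f x - g x\<bar> \<le> \<theta>" and off: "\<And>x. \<bar>f x - g x\<bar> \<le> c"
    and nn: "0 \<le> \<theta>" "0 \<le> c"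
  shows "\<bar>(\<integral>x. f x \<partial>M) - (\<integral>x. g x \<partial>M)\<bar> \<le> \<theta> + c * \<eta>"
proof -
  interpret prob_space M by fact
  let ?u = "\<lambda>x. \<theta> + c * indicator (space M - A) x :: real"
  have ind: "integrable M (indicat_real (space M - A))"
    using A by (intro integrable_real_indicator) (auto simp: emeasure_eq_measure)
  have "\<bar>(\<integral>x. f x \<partial>M) - (\<integral>x. g x \<partial>M)\<bar> = \<bar>\<integral>x. f x - g x \<partial>M\<bar>"
    using int by simp
  also have "\<dots> \<le> (\<integral>x. \<bar>f x - g x\<bar> \<partial>M)" by (rule integral_abs_bound)
  also have "\<dots> \<le> (\<integral>x. ?u x \<partial>M)"
  proof (intro integral_mono)
    show "integrable M ?u" using ind by simp
    show "\<bar>f x - g x\<bar> \<le> ?u x" if "x \<in> space M" for x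
      using on[of x] off[of x] nn that by (cases "x \<in> A") auto
  qed (use int in auto)
  also have "\<dots> = \<theta> + c * (1 - measure M A)"
    using ind A prob_compl[OF A(1)] by (simp add: prob_space)
  also have "\<dots> \<le> \<theta> + c * \<eta>" using A(2) nn by (simp add: mult_left_mono)
  finally show ?thesis .
qed

lemma bounded_lipschitz_borel:
  assumes "1-lipschitz_on UNIV f"
  shows "(f :: 'a::metric_space \<Rightarrow> real) \<in> borel_measurable borel"
  using assms by (intro borel_measurable_continuous_onI lipschitz_on_continuous_on)

text \<open>These three facts are the whole interface to \<open>dual_norm\<close> used later. A real
  supremum is meaningful only over a nonempty family bounded above; the zero function and the bound
  2 provide this.\<close>

lemma
  fixes \<mu> \<nu> :: "'a::metric_space measure"
  assumes \<mu>: "\<mu> \<in> tight_prob_measures UNIV" and \<nu>: "\<nu> \<in> tight_prob_measures UNIV"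
  shows integral_diff_le_dual_norm:
      "\<And>f. (\<And>x. \<bar>f x\<bar> \<le> 1) \<Longrightarrow> 1-lipschitz_on UNIV f \<Longrightarrow>
        (\<integral>x. f x \<partial>\<mu>) - (\<integral>x. f x \<partial>\<nu>) \<le> dual_norm (measure_diff \<mu> \<nu>)"
    and dual_norm_nonneg: "0 \<le> dual_norm (measure_diff \<mu> \<nu>)"
    and less_dual_normE: "\<And>t. t < dual_norm (measure_diff \<mu> \<nu>) \<Longrightarrow>
        \<exists>f. (\<forall>x. \<bar>f x\<bar> \<le> 1) \<and> 1-lipschitz_on UNIV f \<and> t < (\<integral>x. f x \<partial>\<mu>) - (\<integral>x. f x \<partial>\<nu>)"
proof -
  let ?B = "{f. (\<forall>x. \<bar>f x\<bar> \<le> 1) \<and> 1-lipschitz_on UNIV f} :: ('a \<Rightarrow> real) set"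
  interpret M: prob_space \<mu> using \<mu> by (rule tight_prob_measuresD)
  interpret N: prob_space \<nu> using \<nu> by (rule tight_prob_measuresD)
  have si: "signed_integral (measure_diff \<mu> \<nu>) f = (\<integral>x. f x \<partial>\<mu>) - (\<integral>x. f x \<partial>\<nu>)" if "f \<in> ?B" for f
    using that tight_prob_measuresD(2)[OF \<mu>] tight_prob_measuresD(2)[OF \<nu>]
    by (intro signed_integral_measure_diff[where c = 1] M.finite_measure_axioms
        N.finite_measure_axioms) (auto intro: bounded_lipschitz_borel)
  have "signed_integral (measure_diff \<mu> \<nu>) f \<le> 2" if "f \<in> ?B" for f
  proof -
    have i: "integrable \<rho> f" if "\<rho> \<in> tight_prob_measures UNIV" for \<rho>
      using \<open>f \<in> ?B\<close> tight_prob_measuresD[OF that] by (intro integrable_bounded_borel[where c = 1])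
         (auto intro: bounded_lipschitz_borel prob_space.finite_measure)
    have "(\<integral>x. f x \<partial>\<mu>) \<le> 1" "- 1 \<le> (\<integral>x. f x \<partial>\<nu>)"
      using that i[OF \<mu>] i[OF \<nu>]
      by (auto intro!: M.integral_le_const N.integral_ge_const simp: abs_le_iff minus_le_iff)
    then show ?thesis unfolding si[OF that] by simp
  qed
  then have bdd: "bdd_above (signed_integral (measure_diff \<mu> \<nu>) ` ?B)"
    by (intro bdd_aboveI2)
  have zero: "(\<lambda>_. 0) \<in> ?B" by (auto intro: lipschitz_on_constant lipschitz_on_le)
  show le: "(\<integral>x. f x \<partial>\<mu>) - (\<integral>x. f x \<partial>\<nu>) \<le> dual_norm (measure_diff \<mu> \<nu>)"
    if "\<And>x. \<bar>f x\<bar> \<le> 1" "1-lipschitz_on UNIV f" for f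
  proof -
    have "f \<in> ?B" using that by blast
    from cSUP_upper[OF this bdd] show ?thesis by (simp add: si[OF \<open>f \<in> ?B\<close>] dual_norm_def)
  qed
  show "0 \<le> dual_norm (measure_diff \<mu> \<nu>)"
    using le[of "\<lambda>_. 0"] zero by auto
  show "\<exists>f. (\<forall>x. \<bar>f x\<bar> \<le> 1) \<and> 1-lipschitz_on UNIV f \<and> t < (\<integral>x. f x \<partial>\<mu>) - (\<integral>x. f x \<partial>\<nu>)"
    if "t < dual_norm (measure_diff \<mu> \<nu>)" for t
  proof (rule ccontr)
    assume "\<not> ?thesis"
    then have "signed_integral (measure_diff \<mu> \<nu>) f \<le> t" if "f \<in> ?B" for f
      using that unfolding si[OF that] by (auto simp: not_less)
    then have "dual_norm (measure_diff \<mu> \<nu>) \<le> t"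
      unfolding dual_norm_def using zero by (intro cSUP_least) (metis empty_iff)
    with that show False by simp
  qed
qed

text \<open>Each function is coded by its values at finitely many centres, rounded down to multiples
  of \<open>\<delta> / 4\<close>. There are finitely many codes, and functions with equal codes
  differ on \<open>C\<close> by less than \<open>3 * \<delta> / 4\<close>: once for the rounding,
  twice for the Lipschitz step to a centre. One representative per code is kept. It is a function on
  the whole space, so it can be integrated against every \<open>\<mu> j\<close> and
  \<open>\<nu> j\<close>.\<close>

lemma bounded_lipschitz_totally_bounded_on_compact:
  fixes C :: "'a::metric_space set" and \<delta> :: real
  assumes C: "compact C" and \<delta>: "0 < \<delta>"
  defines "B \<equiv> {f. (\<forall>x. \<bar>f x\<bar> \<le> 1) \<and> 1-lipschitz_on UNIV f} :: ('a \<Rightarrow> real) set"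
  obtains G where "finite G" "G \<subseteq> B" "\<And>f. f \<in> B \<Longrightarrow> \<exists>u\<in>G. \<forall>x\<in>C. \<bar>f x - u x\<bar> \<le> \<delta>"
proof -
  have d4: "0 < \<delta> / 4" using \<delta> by simp
  obtain D where D: "finite D" "C \<subseteq> (\<Union>p\<in>D. ball p (\<delta> / 4))"
    using C d4 compact_eq_totally_bounded[of C] by metis
  define \<Phi> where "\<Phi> f = (\<lambda>p\<in>D. \<lfloor>f p * (4 / \<delta>)\<rfloor>)" for f :: "'a \<Rightarrow> real"
  have "\<Phi> f \<in> (\<Pi>\<^sub>E p\<in>D. {\<lfloor>- 4 / \<delta>\<rfloor>..\<lfloor>4 / \<delta>\<rfloor>})" if "f \<in> B" for f
  proof -
    have "- 4 / \<delta> \<le> f p * (4 / \<delta>) \<and> f p * (4 / \<delta>) \<le> 4 / \<delta>" for p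
    proof -
      have "- 1 \<le> f p" "f p \<le> 1" using that by (auto simp: B_def abs_le_iff minus_le_iff)
      then show ?thesis
        using \<delta> mult_right_mono[of "- 1" "f p" "4 / \<delta>"] mult_right_mono[of "f p" 1 "4 / \<delta>"]
        by simp
    qed
    then show ?thesis unfolding \<Phi>_def by (auto intro!: floor_mono)
  qed
  then have "finite (\<Phi> ` B)"
    using finite_PiE[OF D(1), of "\<lambda>_. {\<lfloor>- 4 / \<delta>\<rfloor>..\<lfloor>4 / \<delta>\<rfloor>}"]
    by (intro finite_subset[of "\<Phi> ` B"]) auto
  define G where "G = inv_into B \<Phi> ` \<Phi> ` B"
  have "finite G" using \<open>finite (\<Phi> ` B)\<close> by (simp add: G_def)
  moreover have "G \<subseteq> B" by (auto simp: G_def inv_into_into)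
  moreover have "\<exists>u\<in>G. \<forall>x\<in>C. \<bar>f x - u x\<bar> \<le> \<delta>" if f: "f \<in> B" for f
  proof -
    define u where "u = inv_into B \<Phi> (\<Phi> f)"
    have u: "u \<in> G" "u \<in> B" "\<Phi> u = \<Phi> f"
      using f by (auto simp: G_def u_def inv_into_into f_inv_into_f)
    have lip: "\<bar>g x - g y\<bar> \<le> dist x y" if "g \<in> B" for g x y
      using that lipschitz_onD[of 1 UNIV g x y] by (simp add: B_def dist_real_def)
    have "\<bar>f x - u x\<bar> \<le> \<delta>" if "x \<in> C" for x
    proof -
      obtain p where p: "p \<in> D" "dist p x < \<delta> / 4" using D(2) \<open>x \<in> C\<close> by (auto simp: subset_iff)
      have "\<lfloor>f p * (4 / \<delta>)\<rfloor> = \<lfloor>u p * (4 / \<delta>)\<rfloor>"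
        using u(3) p(1) by (auto simp: \<Phi>_def dest: fun_cong[of _ _ p])
      then have "\<bar>f p * (4 / \<delta>) - u p * (4 / \<delta>)\<bar> < 1" by linarith
      then have "\<bar>(f p - u p) * (4 / \<delta>)\<bar> < 1" by (simp only: left_diff_distrib)
      then have "\<bar>f p - u p\<bar> < \<delta> / 4"
        using \<delta> unfolding abs_mult by (simp add: field_simps)
      moreover have "\<bar>f x - f p\<bar> \<le> \<delta> / 4" "\<bar>u x - u p\<bar> \<le> \<delta> / 4"
        using lip[OF f, of x p] lip[OF u(2), of x p] p(2) by (auto simp: dist_commute)
      ultimately show ?thesis using \<delta> by linarith
    qed
    with u show ?thesis by blast
  qed
  ultimately show thesis by (rule that)
qed

section \<open>Bounded uniformly continuous functions: closure properties and truncation\<close>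

lemma bounded_uniformly_continuous_onD:
  assumes "f \<in> bounded_uniformly_continuous_on (UNIV :: 'a::metric_space set)"
  shows "f \<in> borel_measurable borel" "\<exists>c. \<forall>x. \<bar>f x\<bar> \<le> c"
  using assms
  by (auto simp: bounded_uniformly_continuous_on_def bounded_iff
      intro!: borel_measurable_continuous_onI uniformly_continuous_imp_continuous)

lemma integrable_bounded_uniformly_continuous:
  fixes \<rho> :: "'a::metric_space measure"
  assumes "\<rho> \<in> tight_prob_measures UNIV" "f \<in> bounded_uniformly_continuous_on UNIV"
  shows "integrable \<rho> f"
  using bounded_uniformly_continuous_onD[OF assms(2)] tight_prob_measuresD[OF assms(1)]
  by (auto intro!: integrable_bounded_borel simp: prob_space.finite_measure)

lemma bounded_uniformly_continuous_on_add:
  assumes "f \<in> bounded_uniformly_continuous_on A" "g \<in> bounded_uniformly_continuous_on A"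
  shows "(\<lambda>x. f x + g x) \<in> bounded_uniformly_continuous_on A"
  using assms by (auto simp: bounded_uniformly_continuous_on_def
      intro!: uniformly_continuous_on_add bounded_plus_comp)

lemma bounded_uniformly_continuous_onI_Lipschitz:
  fixes f :: "'a::metric_space \<Rightarrow> real"
  assumes "\<And>x. \<bar>f x\<bar> \<le> c" "\<And>x y. \<bar>f x - f y\<bar> \<le> K * dist x y" 
  shows "f \<in> bounded_uniformly_continuous_on UNIV"
proof -
  have "\<bar>f x - f y\<bar> \<le> max 0 K * dist x y" for x y
    using assms(2)[of x y] mult_right_mono[of K "max 0 K" "dist x y"] by simp
  then have "(max 0 K)-lipschitz_on UNIV f"
    by (intro lipschitz_onI) (auto simp: dist_real_def)
  then show ?thesis
    using assms(1) by (auto simp: bounded_uniformly_continuous_on_def bounded_iff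
        intro: lipschitz_on_uniformly_continuous)
qed

text \<open>What is left after clamping to \<open>[-\<theta>, \<theta>]\<close>. Unlike a hard cut
  it erases small values without increasing the Lipschitz constant.\<close>

definition soft_threshold :: "real \<Rightarrow> real \<Rightarrow> real" where
  "soft_threshold \<theta> t = t - max (- \<theta>) (min \<theta> t)"

lemma soft_threshold:
  assumes "0 \<le> \<theta>"
  shows "\<bar>soft_threshold \<theta> s - soft_threshold \<theta> t\<bar> \<le> \<bar>s - t\<bar>"
    and "\<bar>soft_threshold \<theta> t\<bar> \<le> \<bar>t\<bar>" "\<bar>t - soft_threshold \<theta> t\<bar> \<le> \<theta>"
    and "\<bar>t\<bar> \<le> \<theta> \<Longrightarrow> soft_threshold \<theta> t = 0"
  using assms unfolding soft_threshold_def max_def min_def by (simp_all split: if_splits) linarith+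

definition cutoff :: "'a::metric_space set \<Rightarrow> real \<Rightarrow> 'a \<Rightarrow> real" where
  "cutoff L s x = max 0 (1 - infdist x L / s)"

lemma cutoff:
  assumes s: "0 < s" and L: "L \<noteq> {}"
  shows "0 \<le> cutoff L s x" "cutoff L s x \<le> 1" "x \<in> L \<Longrightarrow> cutoff L s x = 1"
    and "\<bar>cutoff L s x - cutoff L s y\<bar> \<le> dist x y / s"
    and "cutoff L s x \<noteq> 0 \<Longrightarrow> \<exists>y\<in>L. dist x y < s"
proof -
  show "0 \<le> cutoff L s x" "cutoff L s x \<le> 1" "x \<in> L \<Longrightarrow> cutoff L s x = 1"
    using s infdist_nonneg[of x L] by (auto simp: cutoff_def)
  have "\<bar>infdist x L - infdist y L\<bar> \<le> dist x y" by (rule infdist_triangle_abs)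
  then have "\<bar>infdist x L / s - infdist y L / s\<bar> \<le> dist x y / s"
    using s by (simp add: divide_right_mono flip: diff_divide_distrib)
  then show "\<bar>cutoff L s x - cutoff L s y\<bar> \<le> dist x y / s"
    unfolding cutoff_def by linarith
  assume "cutoff L s x \<noteq> 0"
  then have "infdist x L < s" using s by (auto simp: cutoff_def max_def field_simps split: if_splits)
  then have "(INF a\<in>L. dist x a) < s" using L by (simp add: infdist_def)
  then show "\<exists>y\<in>L. dist x y < s"
    using L by (subst (asm) cINF_less_iff) auto
qed

text \<open>
  A gliding hump. If the norms do not tend to \<open>0\<close>, there are Lipschitz functions with large
  integral against \<open>\<mu> j - \<nu> j\<close> for infinitely many \<open>j\<close>. Given a compact set \<open>C\<close> carrying almost all
  the mass seen so far, such a function agrees on \<open>C\<close> up to \<open>r\<close> with a member of a fixed finite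
  family, whose integrals are eventually negligible. Subtracting that member, thresholding, and
  cutting off outside a neighbourhood of \<open>L j\<close> gives a hump that vanishes near \<open>C\<close>. The humps have
  a common Lipschitz constant and uniformly separated supports, so their sum is bounded and
  uniformly continuous, and its integrals do not tend to \<open>0\<close>.
\<close>

lemma integral_diff_tendsto_imp_dual_norm_tendsto:
  fixes \<mu> \<nu> :: "nat \<Rightarrow> 'a::metric_space measure"
  assumes \<mu>: "\<And>j. \<mu> j \<in> tight_prob_measures UNIV"
    and \<nu>: "\<And>j. \<nu> j \<in> tight_prob_measures UNIV"
    and lim: "\<And>f. f \<in> bounded_uniformly_continuous_on UNIV \<Longrightarrow>
      (\<lambda>j. (\<integral>x. f x \<partial>\<mu> j) - (\<integral>x. f x \<partial>\<nu> j)) \<longlonglongrightarrow> 0"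
  shows "(\<lambda>j. dual_norm (measure_diff (\<mu> j) (\<nu> j))) \<longlonglongrightarrow> 0"
proof (rule ccontr)
  let ?UB = "bounded_uniformly_continuous_on UNIV :: ('a \<Rightarrow> real) set"
  let ?B = "{f. (\<forall>x. \<bar>f x\<bar> \<le> 1) \<and> 1-lipschitz_on UNIV f} :: ('a \<Rightarrow> real) set"
  define M where "M j f = (\<integral>x. f x \<partial>\<mu> j) - (\<integral>x. f x \<partial>\<nu> j)" for j and f :: "'a \<Rightarrow> real"
  assume "\<not> ?thesis"
  then obtain e where e: "0 < e" "\<And>J. \<exists>j\<ge>J. e \<le> dual_norm (measure_diff (\<mu> j) (\<nu> j))"
    using dual_norm_nonneg[OF \<mu> \<nu>] unfolding LIMSEQ_iff by (auto simp: not_less)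
  define \<epsilon> where "\<epsilon> = e / 2"
  \<comment> \<open>Budget for one hump, starting from an integral above \<epsilon>: the approximant
    takes \<open>\<epsilon> / 8\<close>, thresholding at \<open>3 * r\<close> at most
    \<open>25 * \<epsilon> / 64\<close>, the cutoff \<open>4 * \<eta> \<le> \<epsilon> / 16\<close>.
    More than \<open>27 * \<epsilon> / 64\<close> remains, which exceeds the
    \<open>3 * \<epsilon> / 8\<close> required of a hump.\<close>
  define r where "r = \<epsilon> / 16"
  define \<eta> where "\<eta> = min (\<epsilon> / 64) (1 / 64)"
  \<comment> \<open>Product rule: the bound 2 of \<open>v\<close> times the slope
    \<open>2 / r\<close> of the cutoff, plus the slope 2 of \<open>v\<close>.\<close>
  define K where "K = 2 * (2 / r) + 2"
  have pos: "0 < \<epsilon>" "0 < r" "0 < \<eta>" using e by (auto simp: \<epsilon>_def r_def \<eta>_def)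
  have \<eta>_le: "\<eta> \<le> \<epsilon> / 64" by (simp add: \<eta>_def)
  have big: "\<exists>j\<ge>J. \<exists>f\<in>?B. \<epsilon> < M j f" for J
  proof -
    obtain j where j: "j \<ge> J" "e \<le> dual_norm (measure_diff (\<mu> j) (\<nu> j))" using e(2) by blast
    then have "\<epsilon> < dual_norm (measure_diff (\<mu> j) (\<nu> j))" using e(1) by (simp add: \<epsilon>_def)
    from less_dual_normE[OF \<mu> \<nu> this] j(1) show ?thesis unfolding M_def by blast
  qed
  have "\<exists>L. compact L \<and> L \<noteq> {} \<and> 1 - measure (\<mu> j) L \<le> \<eta> \<and> 1 - measure (\<nu> j) L \<le> \<eta>" for j
  proof -
    obtain C where C: "compact C" "1 - \<eta> < measure (\<mu> j) C"
      using tight_prob_measures_compact[OF \<mu> pos(3)] by blast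
    obtain D where D: "compact D" "1 - \<eta> < measure (\<nu> j) D"
      using tight_prob_measures_compact[OF \<nu> pos(3)] by blast
    interpret P: prob_space "\<mu> j" using \<mu> by (rule tight_prob_measuresD)
    interpret Q: prob_space "\<nu> j" using \<nu> by (rule tight_prob_measuresD)
    \<comment> \<open>The extra point makes the set visibly nonempty; \<open>infdist\<close> to the
      empty set is 0, which would spoil \<open>cutoff\<close>.\<close>
    let ?L = "insert undefined (C \<union> D)"
    have "compact ?L" using C D by (simp add: compact_Un)
    then have "?L \<in> sets borel" by (rule borel_compact)
    then have "measure (\<mu> j) C \<le> measure (\<mu> j) ?L" "measure (\<nu> j) D \<le> measure (\<nu> j) ?L"
      by (auto intro!: P.finite_measure_mono Q.finite_measure_mono
          simp: tight_prob_measuresD[OF \<mu>] tight_prob_measuresD[OF \<nu>])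
    with C D \<open>compact ?L\<close> show ?thesis by (intro exI[of _ ?L]) auto
  qed
  then obtain L where L: "\<And>j. compact (L j)" "\<And>j. L j \<noteq> {}"
    "\<And>j. 1 - measure (\<mu> j) (L j) \<le> \<eta>" "\<And>j. 1 - measure (\<nu> j) (L j) \<le> \<eta>" by metis
  have M_close: "\<bar>M j f - M j g\<bar> \<le> 2 * (\<theta> + c * \<eta>)"
    if "f \<in> ?UB" "g \<in> ?UB" "\<And>x. x \<in> L j \<Longrightarrow> \<bar>f x - g x\<bar> \<le> \<theta>" "\<And>x. \<bar>f x - g x\<bar> \<le> c"
      "0 \<le> \<theta>" "0 \<le> c" for j f g \<theta> c
  proof -
    have "L j \<in> sets borel" using L(1) by (rule borel_compact)
    then have "\<bar>(\<integral>x. f x \<partial>\<mu> j) - (\<integral>x. g x \<partial>\<mu> j)\<bar> \<le> \<theta> + c * \<eta>"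
      "\<bar>(\<integral>x. f x \<partial>\<nu> j) - (\<integral>x. g x \<partial>\<nu> j)\<bar> \<le> \<theta> + c * \<eta>"
      using that L \<mu> \<nu> by (auto intro!: abs_integral_diff_le[where A = "L j"]
          integrable_bounded_uniformly_continuous simp: tight_prob_measuresD)
    moreover have "M j f - M j g =
        ((\<integral>x. f x \<partial>\<mu> j) - (\<integral>x. g x \<partial>\<mu> j)) - ((\<integral>x. f x \<partial>\<nu> j) - (\<integral>x. g x \<partial>\<nu> j))"
      by (simp add: M_def)
    ultimately show ?thesis by (smt (verit))
  qed
  have M_add: "M j (\<lambda>x. f x + g x) = M j f + M j g" if "f \<in> ?UB" "g \<in> ?UB" for j f g
    using that \<mu> \<nu> by (simp add: M_def integrable_bounded_uniformly_continuous)
  have M_diff: "M j (\<lambda>x. f x - g x) = M j f - M j g" if "f \<in> ?UB" "g \<in> ?UB" for j f g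
    using that \<mu> \<nu> by (simp add: M_def integrable_bounded_uniformly_continuous)
  have M_small: "eventually (\<lambda>j. \<bar>M j f\<bar> < t) sequentially" if "f \<in> ?UB" "0 < t" for f t
    using order_tendstoD(2)[OF tendsto_rabs_zero[OF lim[OF that(1)]] that(2)] by (simp add: M_def)
  \<comment> \<open>The bounds 2 and \<open>K\<close> do not depend on \<open>j\<close>. A hump
    stays within \<open>r / 2\<close> of \<open>L j\<close> and vanishes up to distance
    \<open>r\<close> from \<open>C\<close>; since \<open>L j\<close> joins \<open>C\<close>
    afterwards, distinct supports end up at least \<open>r / 2\<close> apart.\<close>
  define hump where "hump C j g \<longleftrightarrow> (\<forall>x. \<bar>g x\<bar> \<le> 2) \<and> (\<forall>x y. \<bar>g x - g y\<bar> \<le> K * dist x y) \<and>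
      (\<forall>c\<in>C. \<forall>x. dist c x \<le> r \<longrightarrow> g x = 0) \<and> (\<forall>x. g x \<noteq> 0 \<longrightarrow> (\<exists>y\<in>L j. dist x y < r / 2)) \<and>
      3 * \<epsilon> / 8 < M j g" for C j and g :: "'a \<Rightarrow> real"
  have hump_UB: "g \<in> ?UB" if "hump C j g" for C j g
    using that unfolding hump_def by (intro bounded_uniformly_continuous_onI_Lipschitz) blast+
  have step: "\<exists>j>J. \<exists>g. hump C j g \<and> \<bar>M j h\<bar> < \<epsilon> / 8" if C: "compact C" and h: "h \<in> ?UB" for C h J
  proof -
    obtain G where G: "finite G" "G \<subseteq> ?B" "\<And>f. f \<in> ?B \<Longrightarrow> \<exists>u\<in>G. \<forall>x\<in>C. \<bar>f x - u x\<bar> \<le> r"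
      by (rule bounded_lipschitz_totally_bounded_on_compact[OF C pos(2)]) (rule that)
    have B_lip: "\<bar>f x - f y\<bar> \<le> dist x y" if "f \<in> ?B" for f x y
      using that lipschitz_onD[of 1 UNIV f x y] by (simp add: dist_real_def)
    have B_bd: "\<bar>f x\<bar> \<le> 1" if "f \<in> ?B" for f x
      using that by blast
    have B_UB: "f \<in> ?UB" if "f \<in> ?B" for f
      using B_lip[OF that] B_bd[OF that]
      by (intro bounded_uniformly_continuous_onI_Lipschitz[where c = 1 and K = 1]) simp_all
    have "0 < \<epsilon> / 8" using pos by simp
    \<comment> \<open>The finite family and \<open>h\<close>, which will be the sum of the earlier
      humps, are fixed before \<open>j\<close> is chosen. So \<open>lim\<close> makes their
      integrals negligible from some index on, and \<open>f\<close> is picked only after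
      that.\<close>
    then have "eventually (\<lambda>j. \<forall>u\<in>G. \<bar>M j u\<bar> < \<epsilon> / 8) sequentially"
      using G(2) B_UB by (intro eventually_ball_finite[OF G(1)] ballI M_small) (rule B_UB, rule subsetD)
    moreover have "eventually (\<lambda>j. \<bar>M j h\<bar> < \<epsilon> / 8) sequentially"
      using h pos by (intro M_small) auto
    ultimately have "eventually (\<lambda>j. (\<forall>u\<in>G. \<bar>M j u\<bar> < \<epsilon> / 8) \<and> \<bar>M j h\<bar> < \<epsilon> / 8) sequentially"
      by (rule eventually_conj)
    then obtain N where N: "\<And>j. j \<ge> N \<Longrightarrow> (\<forall>u\<in>G. \<bar>M j u\<bar> < \<epsilon> / 8) \<and> \<bar>M j h\<bar> < \<epsilon> / 8"
      unfolding eventually_sequentially by blast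
    obtain j f where j: "j \<ge> max N (Suc J)" and f: "f \<in> ?B" "\<epsilon> < M j f"
      using big by blast
    obtain u where u: "u \<in> G" "\<And>x. x \<in> C \<Longrightarrow> \<bar>f x - u x\<bar> \<le> r" using G(3)[OF f(1)] by blast
    have uB: "u \<in> ?B" using u G by blast
    define w where "w x = f x - u x" for x
    \<comment> \<open>On \<open>C\<close> the difference \<open>w\<close> is at most
      \<open>r\<close>, and it is 2-Lipschitz; so it is at most \<open>3 * r\<close> within distance
      \<open>r\<close> of \<open>C\<close>, and the threshold erases it there.\<close>
    define v where "v x = soft_threshold (3 * r) (w x)" for x
    define g where "g x = v x * cutoff (L j) (r / 2) x" for x
    have r3: "0 \<le> 3 * r" and r2: "0 < r / 2" using pos by auto
    note st = soft_threshold[OF r3] and ct = cutoff[OF r2 L(2)[of j]]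
    have w: "\<bar>w x\<bar> \<le> 2" "\<bar>w x - w y\<bar> \<le> 2 * dist x y" for x y
      using B_bd[OF f(1), of x] B_bd[OF uB, of x] B_lip[OF f(1), of x y] B_lip[OF uB, of x y]
      unfolding w_def by linarith+
    have v: "\<bar>v x\<bar> \<le> 2" "\<bar>v x - v y\<bar> \<le> 2 * dist x y" for x y
      using st(1)[of "w x" "w y"] st(2)[of "w x"] w[of x] w(2)[of x y] unfolding v_def by linarith+
    have gv: "\<bar>g x\<bar> \<le> \<bar>v x\<bar>" for x
      using ct(1,2)[of x] by (simp add: g_def abs_mult mult_left_le)
    have g_bd: "\<bar>g x\<bar> \<le> 2" for x using gv[of x] v(1)[of x] by linarith
    have g_lip: "\<bar>g x - g y\<bar> \<le> K * dist x y" for x y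
    proof -
      let ?c = "cutoff (L j) (r / 2)"
      have "g x - g y = v x * (?c x - ?c y) + (v x - v y) * ?c y"
        by (simp add: g_def algebra_simps)
      then have "\<bar>g x - g y\<bar> \<le> \<bar>v x\<bar> * \<bar>?c x - ?c y\<bar> + \<bar>v x - v y\<bar> * \<bar>?c y\<bar>"
        by (metis abs_mult abs_triangle_ineq)
      also have "\<dots> \<le> 2 * (dist x y / (r / 2)) + (2 * dist x y) * 1"
        using v[of x] v(2)[of x y] ct(1,2)[of y] ct(4)[of x y] by (intro add_mono mult_mono) auto
      also have "\<dots> = K * dist x y" by (simp add: K_def algebra_simps)
      finally show ?thesis .
    qed
    have gUB: "g \<in> ?UB" using g_bd g_lip by (rule bounded_uniformly_continuous_onI_Lipschitz)
    have vUB: "v \<in> ?UB" using v by (rule bounded_uniformly_continuous_onI_Lipschitz)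
    have wUB: "w \<in> ?UB" using w by (rule bounded_uniformly_continuous_onI_Lipschitz)
    have zero: "g x = 0" if "c \<in> C" "dist c x \<le> r" for c x
    proof -
      have "\<bar>w c\<bar> \<le> r" using u(2)[OF that(1)] by (simp add: w_def)
      moreover have "\<bar>w c - w x\<bar> \<le> 2 * r" using w(2)[of c x] that(2) by linarith
      ultimately have "v x = 0" unfolding v_def by (intro st(4)) linarith
      then show ?thesis by (simp add: g_def)
    qed
    have near: "\<exists>y\<in>L j. dist x y < r / 2" if "g x \<noteq> 0" for x
      using that ct(5)[of x] by (simp add: g_def)
    have "\<bar>M j w - M j v\<bar> \<le> 2 * (3 * r + 3 * r * \<eta>)"
      using st(3) pos by (intro M_close wUB vUB) (auto simp: v_def)
    also have "3 * r * \<eta> \<le> 3 * r * (1 / 64)"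
      using pos by (intro mult_left_mono) (auto simp: \<eta>_def)
    finally have "\<bar>M j w - M j v\<bar> \<le> 25 * \<epsilon> / 64" using pos(1) by (simp add: r_def)
    moreover have "\<bar>M j v - M j g\<bar> \<le> 2 * (0 + 2 * \<eta>)"
    proof (intro M_close vUB gUB)
      show "\<bar>v x - g x\<bar> \<le> 0" if "x \<in> L j" for x using ct(3)[OF that] by (simp add: g_def)
      show "\<bar>v x - g x\<bar> \<le> 2" for x
      proof -
        have "v x - g x = v x * (1 - cutoff (L j) (r / 2) x)" by (simp add: g_def algebra_simps)
        then have "\<bar>v x - g x\<bar> \<le> \<bar>v x\<bar>"
          using ct(1,2)[of x] by (simp add: abs_mult mult_left_le)
        then show ?thesis using v(1)[of x] by linarith
      qed
    qed auto
    moreover have "M j w = M j f - M j u" 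
      unfolding w_def using f uB by (intro M_diff B_UB)
    moreover have "\<bar>M j u\<bar> < \<epsilon> / 8" using N[of j] j u by auto
    ultimately have "3 * \<epsilon> / 8 < M j g"
      using f(2) pos(1) \<eta>_le unfolding abs_le_iff abs_less_iff by argo
    then have "hump C j g \<and> \<bar>M j h\<bar> < \<epsilon> / 8"
      unfolding hump_def using N[of j] j g_bd g_lip zero near by auto
    moreover have "j > J" using j by simp
    ultimately show ?thesis by blast
  qed
  \<comment> \<open>A state records the last index, the last hump, the union of the carriers used so
    far and the sum of the humps so far.\<close>
  define P where "P n s \<longleftrightarrow>
      (case s of (j, g, C, h) \<Rightarrow> compact C \<and> h \<in> ?UB \<and> (n = 0 \<longrightarrow> h = (\<lambda>_. 0)))"
    for n :: nat and s :: "nat \<times> ('a \<Rightarrow> real) \<times> 'a set \<times> ('a \<Rightarrow> real)"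
  define Q where "Q s s' \<longleftrightarrow> (case (s, s') of ((j, g, C, h), (j', g', C', h')) \<Rightarrow>
      j' > j \<and> hump C j' g' \<and> \<bar>M j' h\<bar> < \<epsilon> / 8 \<and> C' = C \<union> L j' \<and> h' = (\<lambda>x. h x + g' x))"
    for s s' :: "nat \<times> ('a \<Rightarrow> real) \<times> 'a set \<times> ('a \<Rightarrow> real)"
  have "\<exists>s. \<forall>n. P n (s n) \<and> Q (s n) (s (Suc n))"
  proof (rule dependent_nat_choice)
    show "\<exists>s. P 0 s"
      by (intro exI[of _ "(0, \<lambda>_. 0, {}, \<lambda>_. 0)"])
         (auto simp: P_def intro: bounded_uniformly_continuous_onI_Lipschitz[where c = 0 and K = 0])
    show "\<exists>s'. P (Suc n) s' \<and> Q s s'" if "P n s" for s n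
    proof -
      obtain j g C h where s: "s = (j, g, C, h)" by (cases s)
      have C: "compact C" and h: "h \<in> ?UB" using that by (auto simp: P_def s)
      obtain j' g' where j': "j' > j" and g': "hump C j' g'" "\<bar>M j' h\<bar> < \<epsilon> / 8"
        using step[OF C h] by blast
      let ?s' = "(j', g', C \<union> L j', \<lambda>x. h x + g' x)"
      have "P (Suc n) ?s'" unfolding P_def
        using C h L(1) hump_UB[OF g'(1)] by (auto intro: bounded_uniformly_continuous_on_add)
      moreover have "Q s ?s'" unfolding Q_def s using j' g' by simp
      ultimately show ?thesis by blast
    qed
  qed
  then obtain s where s: "\<And>n. P n (s n)" "\<And>n. Q (s n) (s (Suc n))" by blast
  define j where "j n = fst (s n)" for n
  define g where "g n = fst (snd (s n))" for n
  define C where "C n = fst (snd (snd (s n)))" for n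
  define h where "h n = snd (snd (snd (s n)))" for n
  have s_eq: "s n = (j n, g n, C n, h n)" for n by (simp add: j_def g_def C_def h_def)
  have hUB: "h n \<in> ?UB" for n using s(1)[of n] by (auto simp: P_def s_eq)
  have j: "j n < j (Suc n)" and hp: "hump (C n) (j (Suc n)) (g (Suc n))"
    and Mh: "\<bar>M (j (Suc n)) (h n)\<bar> < \<epsilon> / 8"
    and CS: "C (Suc n) = C n \<union> L (j (Suc n))" and hS: "h (Suc n) = (\<lambda>x. h n x + g (Suc n) x)" for n
    using s(2)[of n] by (auto simp: Q_def s_eq)
  have C_mono: "C m \<subseteq> C n" if "m \<le> n" for m n
    using that by (rule lift_Suc_mono_le[of C, rotated]) (auto simp: CS)
  \<comment> \<open>\<open>g 0\<close> is only a placeholder in the initial state; the humps start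
    with \<open>g 1\<close>.\<close>
  define G where "G n = g (Suc n)" for n
  have G: "\<bar>G n x\<bar> \<le> 2" "\<bar>G n x - G n y\<bar> \<le> K * dist x y"
    "c \<in> C n \<Longrightarrow> dist c x \<le> r \<Longrightarrow> G n x = 0" "G n x \<noteq> 0 \<Longrightarrow> \<exists>y\<in>L (j (Suc n)). dist x y < r / 2"
    for n x y c
    using hp[of n] unfolding hump_def G_def by blast+
  have L_C: "L (j (Suc m)) \<subseteq> C n" if "m < n" for m n
    using C_mono[of "Suc m" n] that by (auto simp: CS)
  have "G m x = 0 \<or> G n y = 0" if "dist x y < r / 2" "m < n" for m n x y
  proof (rule ccontr)
    assume n: "\<not> ?thesis"
    then obtain c where c: "c \<in> L (j (Suc m))" "dist x c < r / 2" using G(4) by blast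
    then have "dist c y \<le> r" using dist_triangle[of c y x] that(1) by (simp add: dist_commute)
    then show False using G(3)[of c n y] c L_C[OF that(2)] n by blast
  qed
  then have sep: "m = n" if "G m x \<noteq> 0" "G n y \<noteq> 0" "dist x y < r / 2" for m n x y
    using that by (metis dist_commute linorder_neqE_nat)
  have single: "\<exists>n. \<forall>m. m \<noteq> n \<longrightarrow> G m x = 0" for x
    using sep[of _ x _ x] pos by (metis dist_self half_gt_zero)
  \<comment> \<open>By \<open>single\<close> at most one index contributes, so the index set is
    finite and the default value of infinite sums never appears.\<close>
  define F where "F x = (\<Sum>n | G n x \<noteq> 0. G n x)" for x
  have F_eq: "F x = G n x" if "\<And>m. m \<noteq> n \<Longrightarrow> G m x = 0" for n x
  proof -
    have "{m. G m x \<noteq> 0} = (if G n x = 0 then {} else {n})"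
      using that by (auto split: if_splits) metis+
    then show ?thesis by (simp add: F_def)
  qed
  \<comment> \<open>At distances below \<open>r / 2\<close> only one hump is visible, so
    \<open>F\<close> inherits the common Lipschitz bound \<open>K\<close> at that scale.\<close>
  have common: "\<exists>n. F x = G n x \<and> F y = G n y" if "dist x y < r / 2" for x y
  proof -
    have "\<exists>n. (\<forall>m. m \<noteq> n \<longrightarrow> G m x = 0) \<and> (\<forall>m. m \<noteq> n \<longrightarrow> G m y = 0)"
    proof (cases "\<exists>n. G n x \<noteq> 0 \<or> G n y \<noteq> 0")
      case True
      then obtain n where n: "G n x \<noteq> 0 \<or> G n y \<noteq> 0" by blast
      have d: "dist x x < r / 2" "dist y y < r / 2" "dist y x < r / 2"
        using that pos by (auto simp: dist_commute)
      show ?thesis using n sep[of _ x n x] sep[of _ x n y] sep[of _ y n x] sep[of _ y n y] d that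
        by (intro exI[of _ n]) metis
    qed auto
    then show ?thesis using F_eq by metis
  qed
  have F_bd: "\<bar>F x\<bar> \<le> 2" for x
    using common[of x x] pos G(1) by auto
  have "uniformly_continuous_on UNIV F"
    unfolding uniformly_continuous_on_def
  proof (intro allI impI)
    fix t :: real assume "0 < t"
    have K: "0 < K" using pos by (auto simp: K_def intro: add_nonneg_pos)
    show "\<exists>d>0. \<forall>x\<in>UNIV. \<forall>y\<in>UNIV. dist y x < d \<longrightarrow> dist (F y) (F x) < t"
    proof (intro exI[of _ "min (r / 2) (t / K)"] conjI ballI impI)
      show "0 < min (r / 2) (t / K)" using pos K \<open>0 < t\<close> by simp
      fix x y :: 'a assume d: "dist y x < min (r / 2) (t / K)"
      then obtain n where n: "F y = G n y" "F x = G n x" using common[of y x] by auto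
      have "\<bar>G n y - G n x\<bar> \<le> K * dist y x" by (rule G)
      also have "\<dots> < t" using d K by (simp add: field_simps)
      finally show "dist (F y) (F x) < t" by (simp add: n dist_real_def)
    qed
  qed
  then have FUB: "F \<in> ?UB"
    using F_bd by (auto simp: bounded_uniformly_continuous_on_def bounded_iff)
  have hG: "h n x = (\<Sum>m<n. G m x)" for n x
  proof (induction n)
    case 0
    show ?case using s(1)[of 0] by (simp add: P_def s_eq)
  qed (simp add: hS G_def)
  have hF: "F x = h n x \<or> (\<exists>m\<ge>n. F x - h n x = G m x)" for n x
  proof -
    obtain k where k: "\<And>m. m \<noteq> k \<Longrightarrow> G m x = 0" using single by blast
    have "h n x = (\<Sum>m<n. if m = k then G k x else 0)"
      unfolding hG using k by (intro sum.cong) auto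
    then have "h n x = (if k < n then G k x else 0)" by simp
    then show ?thesis using F_eq[of k x] k by (auto simp: not_less)
  qed
  have "M (j (Suc n)) F > \<epsilon> / 16" for n
  proof -
    \<comment> \<open>The humps after \<open>G n\<close> vanish on \<open>L (j (Suc n))\<close>, so
      they matter only on the small mass outside it. The earlier ones contribute less than
      \<open>\<epsilon> / 8\<close> by \<open>Mh\<close>, and
      \<open>3 * \<epsilon> / 8 - \<epsilon> / 8 - \<epsilon> / 16\<close> is still above
      \<open>\<epsilon> / 16\<close>.\<close>
    have "\<bar>M (j (Suc n)) F - M (j (Suc n)) (h (Suc n))\<bar> \<le> 2 * (0 + 2 * \<eta>)"
    proof (intro M_close FUB hUB)
      show "\<bar>F x - h (Suc n) x\<bar> \<le> 0" if "x \<in> L (j (Suc n))" for x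
        using hF[of x "Suc n"] G(3)[of x _ x] L_C[of n] that pos by (fastforce simp: Suc_le_eq)
      show "\<bar>F x - h (Suc n) x\<bar> \<le> 2" for x
        using hF[of x "Suc n"] G(1)[of _ x] by auto
    qed auto
    moreover have "M (j (Suc n)) (h (Suc n)) = M (j (Suc n)) (h n) + M (j (Suc n)) (g (Suc n))"
      unfolding hS using hUB hump_UB[OF hp] by (rule M_add)
    moreover have "3 * \<epsilon> / 8 < M (j (Suc n)) (g (Suc n))" using hp[of n] by (simp add: hump_def)
    ultimately show ?thesis
      using Mh[of n] \<eta>_le pos(1) unfolding abs_le_iff abs_less_iff by argo
  qed
  note large = this
  have "eventually (\<lambda>i. \<bar>M i F\<bar> < \<epsilon> / 16) sequentially" using FUB pos by (intro M_small) auto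
  then obtain N where N: "\<And>i. i \<ge> N \<Longrightarrow> \<bar>M i F\<bar> < \<epsilon> / 16" unfolding eventually_sequentially by blast
  have "strict_mono j" using j by (rule strict_monoI_Suc)
  then have "j (Suc N) \<ge> N" using seq_suble[of j "Suc N"] by simp
  then show False using N large[of N] by fastforce
qed

section \<open>Couplings\<close>

text \<open>
  Among all \<open>c\<close> supported on \<open>R\<close> with the prescribed row sums, take one that minimises the sum of the
  squared overloads of the columns. By minimality every \<open>R\<close>-neighbour of a row that feeds a column of
  maximal overload has maximal overload itself, so a positive maximum contradicts the hypothesis
  for the set of these rows. No augmenting paths are needed.
\<close>

lemma fractional_marriage:
  fixes a :: "'i \<Rightarrow> real" and b :: "'k \<Rightarrow> real"
  assumes I: "finite I" and J: "finite J"
    and a: "\<And>i. i \<in> I \<Longrightarrow> 0 \<le> a i"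
    and hall: "\<And>X. X \<subseteq> I \<Longrightarrow> sum a X \<le> sum b {k\<in>J. \<exists>i\<in>X. R i k}"
    and b: "\<And>k. k \<in> J \<Longrightarrow> 0 \<le> b k"
  obtains c :: "'i \<Rightarrow> 'k \<Rightarrow> real" where
    "\<And>i k. 0 \<le> c i k"
    "\<And>i k. c i k \<noteq> 0 \<Longrightarrow> i \<in> I \<and> k \<in> J \<and> R i k"
    "\<And>i. i \<in> I \<Longrightarrow> (\<Sum>k\<in>J. c i k) = a i"
    "\<And>k. k \<in> J \<Longrightarrow> (\<Sum>i\<in>I. c i k) \<le> b k"
proof -
  define E where "E = {(i, k). i \<in> I \<and> k \<in> J \<and> R i k}"
  \<comment> \<open>The upper bounds are implied by the row sums; they are imposed to get
    compactness from the product topology. Coordinates outside \<open>E\<close> are frozen at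
    0.\<close>
  define box where "box = PiE UNIV (\<lambda>p. if p \<in> E then {0..a (fst p)} else {0})"
  define S where "S = box \<inter> (\<Inter>i\<in>I. {c. (\<Sum>k\<in>J. c (i, k)) = a i})"
  define over where "over c k = max 0 ((\<Sum>i\<in>I. c (i, k)) - b k)" for c :: "'i \<times> 'k \<Rightarrow> real" and k
  define \<Phi> where "\<Phi> c = (\<Sum>k\<in>J. (over c k)\<^sup>2)" for c
  have "compactin (product_topology (\<lambda>_. euclidean) UNIV) box"
    unfolding box_def compactin_PiE by auto
  then have "compact box"
    by (simp add: euclidean_product_topology)
  moreover have "closed (\<Inter>i\<in>I. {c :: 'i \<times> 'k \<Rightarrow> real. (\<Sum>k\<in>J. c (i, k)) = a i})"
    by (intro closed_INT ballI closed_Collect_eq continuous_intros continuous_on_product_coordinates)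
  ultimately have "compact S"
    unfolding S_def by (rule compact_Int_closed)
  moreover have "S \<noteq> {}"
  proof -
    have "\<exists>k\<in>J. R i k" if "i \<in> I" "a i \<noteq> 0" for i
    proof (rule ccontr)
      assume "\<not> ?thesis"
      then have "{k\<in>J. \<exists>i'\<in>{i}. R i' k} = {}" by auto
      then have "sum b {k\<in>J. \<exists>i'\<in>{i}. R i' k} = 0" by (simp only: sum.empty)
      then show False using hall[of "{i}"] a[of i] that by simp
    qed
    then obtain s where s: "\<And>i. i \<in> I \<Longrightarrow> a i \<noteq> 0 \<Longrightarrow> s i \<in> J \<and> R i (s i)"
      by metis
    \<comment> \<open>The hypothesis for singletons gives every row of positive weight a neighbour;
      the whole row is put there, whatever the overload.\<close>
    let ?c = "\<lambda>p. if fst p \<in> I \<and> snd p = s (fst p) then a (fst p) else 0"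
    have "(\<Sum>k\<in>J. ?c (i, k)) = a i" if "i \<in> I" for i
      using s[OF that] J that by (cases "a i = 0") (auto simp: sum.delta')
    moreover have "?c p \<in> (if p \<in> E then {0..a (fst p)} else {0})" for p
      using s a by (auto simp: E_def) 
    ultimately have "?c \<in> S"
      unfolding S_def box_def by auto
    then show ?thesis by blast
  qed
  moreover have "continuous_on S \<Phi>"
    unfolding \<Phi>_def over_def
    by (intro continuous_intros continuous_on_subset[OF continuous_on_product_coordinates]) auto
  ultimately obtain c where c: "c \<in> S" and min: "\<And>c'. c' \<in> S \<Longrightarrow> \<Phi> c \<le> \<Phi> c'"
    using continuous_attains_inf by metis
  have box: "c p \<in> (if p \<in> E then {0..a (fst p)} else {0})" for p
    using c PiE_mem[of c UNIV "\<lambda>p. if p \<in> E then {0..a (fst p)} else {0}" p]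
    by (simp add: S_def box_def)
  have c0: "0 \<le> c p" for p using box[of p] by (auto split: if_splits)
  have cE: "p \<in> E" if "c p \<noteq> 0" for p using box[of p] that by (auto split: if_splits)
  have row: "(\<Sum>k\<in>J. c (i, k)) = a i" if "i \<in> I" for i using c that by (auto simp: S_def)
  have exch: "over c k \<le> over c k'" if ik: "c (i, k) \<noteq> 0" and R: "R i k'" "k' \<in> J" for i k k'
  proof (rule ccontr)
    assume "\<not> ?thesis"
    then have less: "over c k' < over c k" by simp
    then have ne: "k \<noteq> k'" by auto
    have i: "i \<in> I" "k \<in> J" using cE[OF ik] by (auto simp: E_def)
    \<comment> \<open>Moving \<open>t\<close> from column \<open>k\<close> to column
      \<open>k'\<close> lowers the sum of squares by at least
      \<open>2 * t * (over c k - over c k' - t)\<close>. At most half the gap makes this positive,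
      and \<open>t \<le> c (i, k)\<close> keeps the entries nonnegative.\<close>
    define t where "t = min (c (i, k)) ((over c k - over c k') / 2)"
    have t: "0 < t" "t \<le> c (i, k)" "2 * t \<le> over c k - over c k'"
      using less c0[of "(i, k)"] ik by (auto simp: t_def min_def field_simps)
    define c' where "c' = c((i, k) := c (i, k) - t, (i, k') := c (i, k') + t)"
    have row': "(\<Sum>k\<in>J. c' (i', k)) = a i'" if "i' \<in> I" for i'
    proof (cases "i' = i")
      case True
      have "(\<Sum>l\<in>J. c' (i, l)) = (\<Sum>l\<in>J. c (i, l) + (if l = k' then t else 0) - (if l = k then t else 0))"
        using ne by (intro sum.cong) (auto simp: c'_def)
      also have "\<dots> = a i" using R(2) i J row[of i] by (simp add: sum.distrib sum_subtractf)
      finally show ?thesis using True by simp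
    qed (use row[OF that] in \<open>simp add: c'_def\<close>)
    have c'0: "0 \<le> c' p" for p using c0[of p] t c0[of "(i,k')"] by (auto simp: c'_def)
    have "c' p \<in> (if p \<in> E then {0..a (fst p)} else {0})" for p
    proof (cases "p \<in> E")
      case True
      obtain i' l where p: "p = (i', l)" by (cases p)
      have il: "i' \<in> I" "l \<in> J" using True by (auto simp: E_def p)
      have "c' (i', l) \<le> (\<Sum>k\<in>J. c' (i', k))"
        using il J c'0 by (intro member_le_sum) auto
      then show ?thesis using True row'[OF il(1)] c'0[of p] p by simp
    next
      case False
      moreover have "(i, k) \<in> E" "(i, k') \<in> E" using i R by (auto simp: E_def intro: cE[OF ik])
          (use cE[OF ik] in \<open>auto simp: E_def\<close>)
      ultimately show ?thesis using cE[of p] by (auto simp: c'_def)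
    qed
    then have "c' \<in> S" using row' by (auto simp: S_def box_def)
    then have "\<Phi> c \<le> \<Phi> c'" by (rule min)
    have col: "(\<Sum>i\<in>I. c' (i, l)) = (\<Sum>i\<in>I. c (i, l)) + (if l = k' then t else 0) - (if l = k then t else 0)" for l
    proof -
      have "(\<Sum>i'\<in>I. c' (i', l)) =
          (\<Sum>i'\<in>I. c (i', l) + (if i' = i then (if l = k' then t else 0) - (if l = k then t else 0) else 0))"
        using ne by (intro sum.cong) (auto simp: c'_def)
      then show ?thesis using i I by (simp add: sum.distrib)
    qed
    have o0: "0 \<le> over c k'" by (simp add: over_def)
    then have "over c k = (\<Sum>i\<in>I. c (i, k)) - b k"
      using less by (simp add: over_def max_def split: if_splits)
    then have o1: "over c' k = over c k - t"
      using ne t o0 col[of k] by (simp add: over_def[of c'])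
    have o2: "over c' k' \<le> over c k' + t"
      using ne t col[of k'] by (simp add: over_def max_def)
    have o3: "over c' l = over c l" if "l \<notin> {k, k'}" for l using that col[of l] by (simp add: over_def)
    have split: "\<Phi> d = (over d k)\<^sup>2 + (over d k')\<^sup>2 + (\<Sum>l\<in>J - {k, k'}. (over d l)\<^sup>2)" for d
    proof -
      have "\<Phi> d = (over d k)\<^sup>2 + (\<Sum>l\<in>J - {k}. (over d l)\<^sup>2)"
        unfolding \<Phi>_def using i J by (intro sum.remove) auto
      also have "(\<Sum>l\<in>J - {k}. (over d l)\<^sup>2) = (over d k')\<^sup>2 + (\<Sum>l\<in>J - {k} - {k'}. (over d l)\<^sup>2)"
        using R J ne by (intro sum.remove) auto
      also have "J - {k} - {k'} = J - {k, k'}" by auto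
      finally show ?thesis by simp
    qed
    have "(over c' k')\<^sup>2 \<le> (over c k' + t)\<^sup>2"
      using o2 by (intro power_mono) (auto simp: over_def)
    moreover have "(over c k - t)\<^sup>2 + (over c k' + t)\<^sup>2 < (over c k)\<^sup>2 + (over c k')\<^sup>2"
    proof -
      have "0 < t * (over c k - over c k' - t)" using t by (intro mult_pos_pos) auto
      then show ?thesis by (simp add: power2_eq_square algebra_simps)
    qed
    moreover have "(\<Sum>l\<in>J - {k, k'}. (over c' l)\<^sup>2) = (\<Sum>l\<in>J - {k, k'}. (over c l)\<^sup>2)"
      using o3 by (intro sum.cong) auto
    ultimately have "\<Phi> c' < \<Phi> c"
      unfolding split o1 by linarith
    with \<open>\<Phi> c \<le> \<Phi> c'\<close> show False by simp
  qed
  have "over c k = 0" if "k \<in> J" for k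
  proof (rule ccontr)
    assume "over c k \<noteq> 0"
    define m where "m = Max (over c ` J)"
    have m: "over c l \<le> m" if "l \<in> J" for l using that J by (simp add: m_def)
    have "0 < m" using m[OF \<open>k \<in> J\<close>] \<open>over c k \<noteq> 0\<close> by (auto simp: over_def)
    define T where "T = {l\<in>J. over c l = m}"
    have "m \<in> over c ` J" unfolding m_def using J \<open>k \<in> J\<close> by (intro Max_in) auto
    then have T0: "T \<noteq> {}" by (auto simp: T_def)
    define X where "X = {i\<in>I. \<exists>l\<in>T. c (i, l) \<noteq> 0}"
    have "X \<subseteq> I" by (auto simp: X_def)
    have sub: "{l\<in>J. \<exists>i\<in>X. R i l} \<subseteq> T"
      using exch m by (fastforce simp: X_def T_def intro: antisym)
    have "sum b T < (\<Sum>l\<in>T. \<Sum>i\<in>I. c (i, l))"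
    proof (rule sum_strict_mono)
      show "b l < (\<Sum>i\<in>I. c (i, l))" if "l \<in> T" for l
        using that \<open>0 < m\<close> by (auto simp: T_def over_def max_def split: if_splits)
    qed (use J T0 in \<open>auto simp: T_def\<close>)
    also have "\<dots> = (\<Sum>l\<in>T. \<Sum>i\<in>X. c (i, l))"
      using I by (intro sum.cong refl sum.mono_neutral_right) (auto simp: X_def)
    also have "\<dots> = (\<Sum>i\<in>X. \<Sum>l\<in>T. c (i, l))" by (rule sum.swap)
    also have "\<dots> \<le> (\<Sum>i\<in>X. \<Sum>l\<in>J. c (i, l))"
      using J c0 by (intro sum_mono sum_mono2) (auto simp: T_def)
    also have "\<dots> = sum a X" using row \<open>X \<subseteq> I\<close> by (intro sum.cong) auto
    also have "\<dots> \<le> sum b {l\<in>J. \<exists>i\<in>X. R i l}" by (rule hall) fact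
    also have "\<dots> \<le> sum b T"
      using sub J b by (intro sum_mono2) (auto simp: T_def)
    finally show False by simp
  qed
  then have "(\<Sum>i\<in>I. c (i, k)) \<le> b k" if "k \<in> J" for k
    using that by (fastforce simp: over_def max_def split: if_splits)
  with c0 row cE show thesis
    by (intro that[of "\<lambda>i k. c (i, k)"]) (auto simp: E_def)
qed

section \<open>From a transport plan between blocks to a coupling of the measures\<close>

lemma weighted_indicator_sum_bounds:
  fixes w :: "nat \<Rightarrow> real"
  assumes "disjoint_family_on A {..<n}" "\<And>i. i < n \<Longrightarrow> 0 \<le> w i" "\<And>i. i < n \<Longrightarrow> w i \<le> 1"
  shows "0 \<le> (\<Sum>i<n. w i * indicator (A i) x)" "(\<Sum>i<n. w i * indicator (A i) x) \<le> 1"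
proof -
  show "0 \<le> (\<Sum>i<n. w i * indicator (A i) x)"
    using assms by (intro sum_nonneg) auto
  have "(\<Sum>i<n. w i * indicator (A i) x) \<le> (\<Sum>i<n. indicator (A i) x)"
    using assms by (intro sum_mono) (auto simp: indicator_def)
  also have "\<dots> = indicator (\<Union>i<n. A i) x"
    using assms(1) by (subst indicator_UN_disjoint) auto
  also have "\<dots> \<le> 1" by (simp add: indicator_def)
  finally show "(\<Sum>i<n. w i * indicator (A i) x) \<le> 1" .
qed

lemma emeasure_split_density:
  fixes r :: "'a \<Rightarrow> real"
  assumes "r \<in> borel_measurable M" "\<And>x. 0 \<le> r x" "\<And>x. r x \<le> 1" "X \<in> sets M"
  shows "emeasure M X =
    (\<integral>\<^sup>+x. ennreal (r x) * indicator X x \<partial>M) + (\<integral>\<^sup>+x. ennreal (1 - r x) * indicator X x \<partial>M)"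
proof -
  have "ennreal (r x) * indicator X x + ennreal (1 - r x) * indicator X x = indicator X x" for x
    using assms(2,3)[of x] by (simp flip: distrib_right ennreal_plus)
  then show ?thesis
    using assms by (subst nn_integral_add[symmetric]) auto
qed

text \<open>Stating the result multiplied by \<open>q\<close> covers \<open>q = 0\<close> as well,
  where any law will do and \<open>M\<close> is taken.\<close>

lemma prob_space_normalized_density:
  fixes u :: "'a \<Rightarrow> real"
  assumes "prob_space M" and u: "u \<in> borel_measurable M" "\<And>x. 0 \<le> u x"
    and q: "(\<integral>\<^sup>+x. ennreal (u x) \<partial>M) = ennreal q" "0 \<le> q"
  obtains D where "prob_space D" "sets D = sets M"
    "\<And>X. X \<in> sets M \<Longrightarrow> ennreal q * emeasure D X = (\<integral>\<^sup>+x. ennreal (u x) * indicator X x \<partial>M)"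
    "q \<noteq> 0 \<Longrightarrow> AE x in D. u x \<noteq> 0"
proof (cases "q = 0")
  case True
  have "(\<integral>\<^sup>+x. ennreal (u x) * indicator X x \<partial>M) \<le> (\<integral>\<^sup>+x. ennreal (u x) \<partial>M)" for X
    by (intro nn_integral_mono) (auto simp: indicator_def)
  with True q assms(1) show thesis by (intro that[of M]) auto
next
  case False
  then have q0: "0 < q" using q by simp
  define D where "D = density M (\<lambda>x. ennreal (u x / q))"
  have e: "ennreal q * emeasure D X = (\<integral>\<^sup>+x. ennreal (u x) * indicator X x \<partial>M)" if "X \<in> sets M" for X
  proof -
    have "ennreal q * emeasure D X = ennreal q * (\<integral>\<^sup>+x. ennreal (u x / q) * indicator X x \<partial>M)"
      using u that by (simp add: D_def emeasure_density)
    also have "\<dots> = (\<integral>\<^sup>+x. ennreal q * (ennreal (u x / q) * indicator X x) \<partial>M)"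
      using u that by (intro nn_integral_cmult[symmetric]) auto
    also have "\<dots> = (\<integral>\<^sup>+x. ennreal (u x) * indicator X x \<partial>M)"
      using u q0 by (intro nn_integral_cong) (simp add: mult.assoc[symmetric] flip: ennreal_mult)
    finally show ?thesis .
  qed
  have "(\<integral>\<^sup>+x. ennreal (u x) * indicator (space M) x \<partial>M) = (\<integral>\<^sup>+x. ennreal (u x) \<partial>M)"
    by (intro nn_integral_cong) simp
  then have "ennreal q * emeasure D (space M) = ennreal q * 1"
    using e[of "space M"] q by simp
  then have "emeasure D (space M) = 1"
    using q0 unfolding ennreal_mult_cancel_left by auto
  then have "emeasure D (space D) = 1" by (simp add: D_def)
  then have "prob_space D" by (rule prob_spaceI)
  moreover have "AE x in D. u x \<noteq> 0"
    unfolding D_def using u by (subst AE_density) auto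
  ultimately show thesis using e by (intro that[of D]) (auto simp: D_def)
qed

lemma (in finite_measure) weighted_indicator_sum_integral:
  fixes w :: "nat \<Rightarrow> nat \<Rightarrow> real"
  assumes "\<And>k. k < n \<Longrightarrow> B k \<in> sets M"
  shows "integrable M (\<lambda>y. \<Sum>i<n. \<Sum>k<n. w i k * indicator (B k) y)"
    and "(\<integral>y. (\<Sum>i<n. \<Sum>k<n. w i k * indicator (B k) y) \<partial>M) = (\<Sum>i<n. \<Sum>k<n. w i k * measure M (B k))"
proof -
  have i: "integrable M (\<lambda>y. w i k * indicator (B k) y)" if "k < n" for i k
    using assms[OF that] by (intro integrable_mult_right integrable_real_indicator) (auto simp: emeasure_eq_measure)
  then have i': "integrable M (\<lambda>y. \<Sum>k<n. w i k * indicator (B k) y)" for i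
    by (intro Bochner_Integration.integrable_sum) auto
  then show "integrable M (\<lambda>y. \<Sum>i<n. \<Sum>k<n. w i k * indicator (B k) y)"
    by (rule Bochner_Integration.integrable_sum)
  have "(\<integral>y. (\<Sum>i<n. \<Sum>k<n. w i k * indicator (B k) y) \<partial>M) =
      (\<Sum>i<n. \<integral>y. (\<Sum>k<n. w i k * indicator (B k) y) \<partial>M)"
    using i' by (rule Bochner_Integration.integral_sum)
  also have "\<dots> = (\<Sum>i<n. \<Sum>k<n. \<integral>y. w i k * indicator (B k) y \<partial>M)"
    by (intro sum.cong refl Bochner_Integration.integral_sum i) simp
  also have "\<dots> = (\<Sum>i<n. \<Sum>k<n. w i k * measure M (B k))"
    using assms by (intro sum.cong refl) auto
  finally show "(\<integral>y. (\<Sum>i<n. \<Sum>k<n. w i k * indicator (B k) y) \<partial>M) =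
      (\<Sum>i<n. \<Sum>k<n. w i k * measure M (B k))" .
qed

text \<open>On each rectangle \<open>A i \<times> B k\<close> the product measure is rescaled to
  mass \<open>c i k\<close>; normalised, the sum of these pieces is \<open>G\<close>. Its marginals
  before normalisation have densities \<open>r\<close> and \<open>s\<close>, both at most 1 by the
  row and column bounds. The leftovers \<open>1 - r\<close> and \<open>1 - s\<close> have equal mass
  \<open>q\<close> and are coupled independently, which gives \<open>H\<close>.\<close>

lemma block_coupling:
  fixes c :: "nat \<Rightarrow> nat \<Rightarrow> real"
  assumes "prob_space M" "prob_space N"
    and A: "\<And>i. i < n \<Longrightarrow> A i \<in> sets M" "disjoint_family_on A {..<n}"
    and B: "\<And>k. k < n \<Longrightarrow> B k \<in> sets N" "disjoint_family_on B {..<n}"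
    and c: "\<And>i k. 0 \<le> c i k"
    and row: "\<And>i. i < n \<Longrightarrow> (\<Sum>k<n. c i k) \<le> measure M (A i)"
    and col: "\<And>k. k < n \<Longrightarrow> (\<Sum>i<n. c i k) \<le> measure N (B k)"
  defines "q \<equiv> 1 - (\<Sum>i<n. \<Sum>k<n. c i k)"
  obtains G H where "prob_space G" "prob_space H" "sets G = sets (M \<Otimes>\<^sub>M N)"
    "sets H = sets (M \<Otimes>\<^sub>M N)" "0 \<le> q" "q \<le> 1"
    "\<And>X. X \<in> sets M \<Longrightarrow> emeasure M X =
        ennreal (1 - q) * emeasure G (X \<times> space N) + ennreal q * emeasure H (X \<times> space N)"
    "\<And>Y. Y \<in> sets N \<Longrightarrow> emeasure N Y =
        ennreal (1 - q) * emeasure G (space M \<times> Y) + ennreal q * emeasure H (space M \<times> Y)"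
    "q < 1 \<Longrightarrow> AE p in G. \<exists>i<n. \<exists>k<n. c i k \<noteq> 0 \<and> fst p \<in> A i \<and> snd p \<in> B k"
proof -
  interpret M: prob_space M by fact
  interpret N: prob_space N by fact
  interpret MN: pair_prob_space M N ..
  define a where "a i = measure M (A i)" for i
  define b where "b k = measure N (B k)" for k
  define t where "t = (\<Sum>i<n. \<Sum>k<n. c i k)"
  \<comment> \<open>A null block carries no transport, so the convention that division by zero gives
    0 loses no mass in \<open>\<rho>\<close>, \<open>r\<close> and \<open>s\<close>.\<close>
  have ca: "c i k = 0" if "i < n" "k < n" "a i = 0" for i k
  proof -
    have "c i k \<le> (\<Sum>k<n. c i k)" using that c by (intro member_le_sum) auto
    then show ?thesis using row[of i] that c[of i k] by (simp add: a_def)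
  qed
  have cb: "c i k = 0" if "i < n" "k < n" "b k = 0" for i k
  proof -
    have "c i k \<le> (\<Sum>i<n. c i k)" using that c by (intro member_le_sum[of i _ "\<lambda>i. c i k"]) auto
    then show ?thesis using col[of k] that c[of i k] by (simp add: b_def)
  qed
  define \<rho> where "\<rho> p = (\<Sum>i<n. \<Sum>k<n. c i k / (a i * b k) *
      (indicator (A i) (fst p) * indicator (B k) (snd p)))" for p
  define r where "r x = (\<Sum>i<n. (\<Sum>k<n. c i k) / a i * indicator (A i) x)" for x
  define s where "s y = (\<Sum>k<n. (\<Sum>i<n. c i k) / b k * indicator (B k) y)" for y
  have ab: "0 \<le> a i" "0 \<le> b i" for i by (simp_all add: a_def b_def)
  have \<rho>0: "0 \<le> \<rho> p" for p unfolding \<rho>_def using c ab by (intro sum_nonneg) auto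
  have r: "0 \<le> r x" "r x \<le> 1" for x
    unfolding r_def using A(2) c ab row
    by (intro weighted_indicator_sum_bounds; simp add: sum_nonneg a_def divide_le_eq_1 order_less_le)+
  have s: "0 \<le> s x" "s x \<le> 1" for x
    unfolding s_def using B(2) c ab col
    by (intro weighted_indicator_sum_bounds; simp add: sum_nonneg b_def divide_le_eq_1 order_less_le)+
  have rm[measurable]: "r \<in> borel_measurable M" unfolding r_def using A by measurable
  have sm[measurable]: "s \<in> borel_measurable N" unfolding s_def using B by measurable
  have ind: "indicator (A i) \<in> borel_measurable M" "indicator (B k) \<in> borel_measurable N"
    if "i < n" "k < n" for i k using A B that by auto
  have \<rho>m[measurable]: "\<rho> \<in> borel_measurable (M \<Otimes>\<^sub>M N)"
    unfolding \<rho>_def using ind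
    by (intro borel_measurable_sum borel_measurable_times borel_measurable_const
        measurable_compose[OF measurable_fst] measurable_compose[OF measurable_snd]) auto
  have int: "i < n \<Longrightarrow> integrable M (indicat_real (A i))"
    "k < n \<Longrightarrow> integrable N (indicat_real (B k))" for i k
    using A B by (auto intro!: integrable_real_indicator simp: M.emeasure_eq_measure N.emeasure_eq_measure)
  have inner1: "(\<integral>\<^sup>+y. ennreal (\<rho> (x, y)) \<partial>N) = ennreal (r x)" for x
  proof -
    define w where "w i k = c i k / (a i * b k) * indicator (A i) x" for i k
    have \<rho>w: "\<rho> (x, y) = (\<Sum>i<n. \<Sum>k<n. w i k * indicator (B k) y)" for y
      by (simp add: \<rho>_def w_def mult.assoc)
    have i: "integrable N (\<lambda>y. \<rho> (x, y))"
      unfolding \<rho>w using B(1) by (rule N.weighted_indicator_sum_integral)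
    have "(\<integral>\<^sup>+y. ennreal (\<rho> (x, y)) \<partial>N) = ennreal (\<integral>y. \<rho> (x, y) \<partial>N)"
      using \<rho>0 i by (intro nn_integral_eq_integral) auto
    also have "(\<integral>y. \<rho> (x, y) \<partial>N) = (\<Sum>i<n. \<Sum>k<n. w i k * b k)"
      unfolding \<rho>w b_def using B(1) by (rule N.weighted_indicator_sum_integral)
    also have "\<dots> = r x"
      unfolding r_def w_def sum_divide_distrib sum_distrib_right
      using cb by (intro sum.cong refl) auto
    finally show ?thesis .
  qed
  have inner2: "(\<integral>\<^sup>+x. ennreal (\<rho> (x, y)) \<partial>M) = ennreal (s y)" for y
  proof -
    define w where "w k i = c i k / (a i * b k) * indicator (B k) y" for i k
    have \<rho>w: "\<rho> (x, y) = (\<Sum>k<n. \<Sum>i<n. w k i * indicator (A i) x)" for x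
      unfolding \<rho>_def w_def by (subst sum.swap) (simp add: mult_ac)
    have i: "integrable M (\<lambda>x. \<rho> (x, y))"
      unfolding \<rho>w using A(1) by (rule M.weighted_indicator_sum_integral)
    have "(\<integral>\<^sup>+x. ennreal (\<rho> (x, y)) \<partial>M) = ennreal (\<integral>x. \<rho> (x, y) \<partial>M)"
      using \<rho>0 i by (intro nn_integral_eq_integral) auto
    also have "(\<integral>x. \<rho> (x, y) \<partial>M) = (\<Sum>k<n. \<Sum>i<n. w k i * a i)"
      unfolding \<rho>w a_def using A(1) by (rule M.weighted_indicator_sum_integral)
    also have "\<dots> = s y"
      unfolding s_def w_def sum_divide_distrib sum_distrib_right
      using ca by (intro sum.cong refl) auto
    finally show ?thesis .
  qed
  have int_r: "integrable M r" unfolding r_def using int by auto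
  have int_s: "integrable N s" unfolding s_def using int by auto
  have "(\<integral>x. r x \<partial>M) = (\<Sum>i<n. (\<Sum>k<n. c i k) / a i * a i)"
    unfolding r_def using int A by (simp add: a_def)
  also have "\<dots> = t"
    unfolding t_def using ca by (intro sum.cong refl) auto
  finally have r_t: "(\<integral>x. r x \<partial>M) = t" .
  have "(\<integral>y. s y \<partial>N) = (\<Sum>k<n. (\<Sum>i<n. c i k) / b k * b k)"
    unfolding s_def using int B by (simp add: b_def)
  also have "\<dots> = (\<Sum>k<n. \<Sum>i<n. c i k)"
    using cb by (intro sum.cong refl) auto
  also have "\<dots> = t" unfolding t_def by (rule sum.swap)
  finally have s_t: "(\<integral>y. s y \<partial>N) = t" .
  have t: "0 \<le> t" "t \<le> 1"
    using r int_r unfolding r_t[symmetric] by (auto intro!: integral_nonneg M.integral_le_const)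
  have q: "q = 1 - t" "0 \<le> q" using t by (simp_all add: q_def t_def)
  have r1: "(\<integral>\<^sup>+x. ennreal (1 - r x) \<partial>M) = ennreal q"
    using r int_r r_t by (subst nn_integral_eq_integral) (auto simp: M.prob_space q)
  have s1: "(\<integral>\<^sup>+x. ennreal (1 - s x) \<partial>N) = ennreal q"
    using s int_s s_t by (subst nn_integral_eq_integral) (auto simp: N.prob_space q)
  have nn_r: "(\<integral>\<^sup>+x. ennreal (r x) \<partial>M) = ennreal t"
    using r int_r r_t by (subst nn_integral_eq_integral) auto
  have "(\<integral>\<^sup>+p. ennreal (\<rho> p) \<partial>(M \<Otimes>\<^sub>M N)) = (\<integral>\<^sup>+x. \<integral>\<^sup>+y. ennreal (\<rho> (x, y)) \<partial>N \<partial>M)"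
    by (intro N.nn_integral_fst[symmetric]) simp
  then have \<rho>t: "(\<integral>\<^sup>+p. ennreal (\<rho> p) \<partial>(M \<Otimes>\<^sub>M N)) = ennreal t"
    by (simp add: inner1 nn_r)
  obtain G where G: "prob_space G" "sets G = sets (M \<Otimes>\<^sub>M N)"
    "\<And>X. X \<in> sets (M \<Otimes>\<^sub>M N) \<Longrightarrow>
      ennreal t * emeasure G X = (\<integral>\<^sup>+p. ennreal (\<rho> p) * indicator X p \<partial>(M \<Otimes>\<^sub>M N))"
    "t \<noteq> 0 \<Longrightarrow> AE p in G. \<rho> p \<noteq> 0"
    by (rule prob_space_normalized_density[OF MN.prob_space_axioms \<rho>m \<rho>0 \<rho>t t(1)]) (rule that)
  obtain H1 where H1: "prob_space H1" "sets H1 = sets M"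
    "\<And>X. X \<in> sets M \<Longrightarrow> ennreal q * emeasure H1 X = (\<integral>\<^sup>+x. ennreal (1 - r x) * indicator X x \<partial>M)"
    by (rule prob_space_normalized_density[OF M.prob_space_axioms _ _ r1 q(2)]) (use r in auto)
  obtain H2 where H2: "prob_space H2" "sets H2 = sets N"
    "\<And>X. X \<in> sets N \<Longrightarrow> ennreal q * emeasure H2 X = (\<integral>\<^sup>+x. ennreal (1 - s x) * indicator X x \<partial>N)"
    by (rule prob_space_normalized_density[OF N.prob_space_axioms _ _ s1 q(2)]) (use s in auto)
  interpret H1: prob_space H1 by fact
  interpret H2: prob_space H2 by fact
  have sp: "space H1 = space M" "space H2 = space N"
    using H1(2) H2(2) by (auto dest: sets_eq_imp_space_eq)
  define H where "H = H1 \<Otimes>\<^sub>M H2"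
  have mX: "emeasure M X =
      ennreal (1 - q) * emeasure G (X \<times> space N) + ennreal q * emeasure H (X \<times> space N)"
    if X: "X \<in> sets M" for X
  proof -
    have h: "emeasure H (X \<times> space N) = emeasure H1 X"
      using X H1(2) H2.emeasure_space_1 by (simp add: H_def H2.emeasure_pair_measure_Times flip: sp)
    have "ennreal t * emeasure G (X \<times> space N) =
        (\<integral>\<^sup>+p. ennreal (\<rho> p) * indicator (X \<times> space N) p \<partial>(M \<Otimes>\<^sub>M N))"
      using X by (intro G) auto
    also have "\<dots> = (\<integral>\<^sup>+x. \<integral>\<^sup>+y. ennreal (\<rho> (x, y)) * indicator (X \<times> space N) (x, y) \<partial>N \<partial>M)"
      using X by (intro N.nn_integral_fst[symmetric]) auto
    also have "\<dots> = (\<integral>\<^sup>+x. \<integral>\<^sup>+y. indicator X x * ennreal (\<rho> (x, y)) \<partial>N \<partial>M)"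
      by (intro nn_integral_cong) (auto simp: indicator_def)
    also have "\<dots> = (\<integral>\<^sup>+x. ennreal (r x) * indicator X x \<partial>M)"
      by (intro nn_integral_cong) (simp add: nn_integral_cmult inner1 mult.commute)
    finally have "ennreal t * emeasure G (X \<times> space N) = (\<integral>\<^sup>+x. ennreal (r x) * indicator X x \<partial>M)" .
    then show ?thesis
      using h emeasure_split_density[OF rm r X] H1(3)[OF X] by (simp add: q(1))
  qed
  have mY: "emeasure N Y =
      ennreal (1 - q) * emeasure G (space M \<times> Y) + ennreal q * emeasure H (space M \<times> Y)"
    if Y: "Y \<in> sets N" for Y
  proof -
    have h: "emeasure H (space M \<times> Y) = emeasure H2 Y"
      using Y H2(2) H1.emeasure_space_1 by (simp add: H_def H2.emeasure_pair_measure_Times flip: sp)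
    have "ennreal t * emeasure G (space M \<times> Y) =
        (\<integral>\<^sup>+p. ennreal (\<rho> p) * indicator (space M \<times> Y) p \<partial>(M \<Otimes>\<^sub>M N))"
      using Y by (intro G) auto
    also have "\<dots> = (\<integral>\<^sup>+y. \<integral>\<^sup>+x. ennreal (\<rho> (x, y)) * indicator (space M \<times> Y) (x, y) \<partial>M \<partial>N)"
      using Y by (intro MN.nn_integral_snd[symmetric]) auto
    also have "\<dots> = (\<integral>\<^sup>+y. \<integral>\<^sup>+x. indicator Y y * ennreal (\<rho> (x, y)) \<partial>M \<partial>N)"
      by (intro nn_integral_cong) (auto simp: indicator_def)
    also have "\<dots> = (\<integral>\<^sup>+y. ennreal (s y) * indicator Y y \<partial>N)"
      by (intro nn_integral_cong) (simp add: nn_integral_cmult inner2 mult.commute)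
    finally have "ennreal t * emeasure G (space M \<times> Y) = (\<integral>\<^sup>+y. ennreal (s y) * indicator Y y \<partial>N)" .
    then show ?thesis
      using h emeasure_split_density[OF sm s Y] H2(3)[OF Y] by (simp add: q(1))
  qed
  have "AE p in G. \<exists>i<n. \<exists>k<n. c i k \<noteq> 0 \<and> fst p \<in> A i \<and> snd p \<in> B k" if "q < 1"
  proof -
    have "AE p in G. \<rho> p \<noteq> 0" using G(4) that q by simp
    then show ?thesis
    proof eventually_elim
      case (elim p)
      show ?case
      proof (rule ccontr)
        assume n: "\<not> ?case"
        have "c i k / (a i * b k) * (indicator (A i) (fst p) * indicator (B k) (snd p)) = (0::real)"
          if "i < n" "k < n" for i k
          using n that by (auto simp: indicator_def)
        then have "\<rho> p = 0" unfolding \<rho>_def by (intro sum.neutral ballI) simp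
        with elim show False by blast
      qed
    qed
  qed
  moreover have "prob_space H" unfolding H_def by (rule prob_space_pair) fact+
  moreover have "sets H = sets (M \<Otimes>\<^sub>M N)" unfolding H_def using H1(2) H2(2) by (rule sets_pair_measure_cong)
  ultimately show thesis
    using G(1,2) mX mY q t by (intro that[of G H]) auto
qed

text \<open>A fictitious target block of capacity \<open>2 * \<epsilon>\<close>, adjacent to every source block, absorbs the
  deficiency in the hypothesis of \<open>fractional_marriage\<close>.\<close>

lemma block_transport:
  fixes \<mu> \<nu> :: "'a::metric_space measure"
  assumes \<mu>: "\<mu> \<in> tight_prob_measures UNIV" and \<nu>: "\<nu> \<in> tight_prob_measures UNIV"
    and \<epsilon>: "0 < \<epsilon>" "\<epsilon> < 1" "dual_norm (measure_diff \<mu> \<nu>) \<le> \<epsilon>\<^sup>2"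
  obtains n :: nat and A c where
    "\<And>i. A i \<in> sets borel" "disjoint_family A" "\<And>i k. 0 \<le> c i k"
    "\<And>i. i < n \<Longrightarrow> (\<Sum>k<n. c i k) \<le> measure \<mu> (A i)"
    "\<And>k. k < n \<Longrightarrow> (\<Sum>i<n. c i k) \<le> measure \<nu> (A k)"
    "1 - 3 * \<epsilon> \<le> (\<Sum>i<n. \<Sum>k<n. c i k)"
    "\<And>i k x y. i < n \<Longrightarrow> k < n \<Longrightarrow> c i k \<noteq> 0 \<Longrightarrow> x \<in> A i \<Longrightarrow> y \<in> A k \<Longrightarrow> dist x y \<le> 5 * \<epsilon>"
proof -
  interpret M: prob_space \<mu> using \<mu> by (rule tight_prob_measuresD)
  interpret N: prob_space \<nu> using \<nu> by (rule tight_prob_measuresD)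
  note sets[simp] = tight_prob_measuresD(2)[OF \<mu>] tight_prob_measuresD(2)[OF \<nu>]
  note sp[simp] = tight_prob_measuresD(3)[OF \<mu>] tight_prob_measuresD(3)[OF \<nu>]
  obtain C where C: "compact C" "1 - \<epsilon> < measure \<mu> C"
    using tight_prob_measures_compact[OF \<mu> \<epsilon>(1)] by blast
  obtain D where D: "compact D" "1 - \<epsilon> < measure \<nu> D"
    using tight_prob_measures_compact[OF \<nu> \<epsilon>(1)] by blast
  define K where "K = C \<union> D"
  have K: "compact K" using C D by (simp add: K_def compact_Un)
  then have Kb[simp]: "K \<in> sets borel" by (rule borel_compact)
  have "measure \<mu> C \<le> measure \<mu> K" "measure \<nu> D \<le> measure \<nu> K"
    by (auto intro!: M.finite_measure_mono N.finite_measure_mono simp: K_def[symmetric])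
       (auto simp: K_def)
  with C D have MK: "1 - \<epsilon> < measure \<mu> K" and NK: "1 - \<epsilon> < measure \<nu> K" by linarith+
  obtain F where F: "finite F" "K \<subseteq> (\<Union>p\<in>F. ball p \<epsilon>)"
    using K \<epsilon>(1) compact_eq_totally_bounded[of K] by metis
  obtain ps where ps: "set ps = F" using finite_list[OF F(1)] by blast
  define n where "n = length ps"
  define p where "p i = ps ! i" for i
  define A where "A i = K \<inter> disjointed (\<lambda>i. ball (p i) \<epsilon>) i" for i
  have Ab[simp]: "A i \<in> sets borel" for i
    unfolding A_def disjointed_def by auto
  have disj: "disjoint_family A"
    using disjoint_family_disjointed[of "\<lambda>i. ball (p i) \<epsilon>"]
    by (auto simp: disjoint_family_on_def A_def)
  have A_ball: "dist (p i) x < \<epsilon>" if "x \<in> A i" for i x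
    using that by (auto simp: A_def disjointed_def)
  have AK: "(\<Union>i<n. A i) = K"
  proof -
    have "(\<Union>i<n. A i) = K \<inter> (\<Union>i\<in>{0..<n}. disjointed (\<lambda>i. ball (p i) \<epsilon>) i)"
      by (auto simp: A_def)
    also have "\<dots> = K \<inter> (\<Union>i\<in>{0..<n}. ball (p i) \<epsilon>)" by (simp only: finite_UN_disjointed_eq)
    also have "(\<Union>i\<in>{0..<n}. ball (p i) \<epsilon>) = (\<Union>p\<in>F. ball p \<epsilon>)"
    proof -
      have "F = p ` {0..<n}" by (auto simp: p_def n_def set_conv_nth simp flip: ps)
      then show ?thesis by blast
    qed
    finally show ?thesis using F(2) by (simp add: Int_absorb2)
  qed
  have sumM: "(\<Sum>i\<in>X. measure \<mu> (A i)) = measure \<mu> (\<Union>i\<in>X. A i)" if "finite X" for X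
    using that disj by (intro M.finite_measure_finite_Union[symmetric])
      (auto intro: disjoint_family_on_mono[of X UNIV])
  define a where "a i = measure \<mu> (A i)" for i
  \<comment> \<open>Of the capacity \<open>2 * \<epsilon>\<close>, one \<epsilon> pays for the dual
    norm and one for the mass of \<nu> outside \<open>K\<close>.\<close>
  define b where "b k = (if k = n then 2 * \<epsilon> else measure \<nu> (A k))" for k
  \<comment> \<open>If two blocks of radius \<epsilon> contain points less than \<epsilon> apart,
    their centres are less than \<open>3 * \<epsilon>\<close> apart. Conversely, any points of two
    related real blocks are within \<open>5 * \<epsilon>\<close>.\<close>
  define R where "R i k \<longleftrightarrow> k = n \<or> dist (p i) (p k) < 3 * \<epsilon>" for i k
  have hall: "sum a X \<le> sum b {k\<in>{..n}. \<exists>i\<in>X. R i k}" if X: "X \<subseteq> {..<n}" for X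
  \<comment> \<open>The empty union is set apart because \<open>infdist\<close> to the empty set is
    0, and because the fictitious block is a neighbour only of a nonempty \<open>X\<close>.\<close>
  proof (cases "(\<Union>i\<in>X. A i) = {}")
    case True
    then have "sum a X = 0" by (intro sum.neutral) (auto simp: a_def)
    also have "\<dots> \<le> sum b {k\<in>{..n}. \<exists>i\<in>X. R i k}" using \<epsilon> by (intro sum_nonneg) (auto simp: b_def)
    finally show ?thesis .
  next
    case False
    define AX where "AX = (\<Union>i\<in>X. A i)"
    have AX0: "AX \<noteq> {}" using False by (simp only: AX_def) simp
    have finX: "finite X" using X finite_subset by blast
    have AXb[simp]: "AX \<in> sets borel" unfolding AX_def using finX by auto
    define N' where "N' = {k. k < n \<and> (\<exists>i\<in>X. dist (p i) (p k) < 3 * \<epsilon>)}"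
    define W where "W = {x. infdist x AX < \<epsilon>}"
    have "open W" unfolding W_def
      by (intro open_Collect_less continuous_intros)
    then have Wb[simp]: "W \<in> sets borel" by simp
    \<comment> \<open>A tent of slope 1 has height only \<epsilon>, so comparing masses means
      dividing by \<epsilon>; this is why the dual norm is assumed to be at most
      \<open>\<epsilon>\<^sup>2\<close>.\<close>
    define f where "f x = max 0 (\<epsilon> - infdist x AX)" for x
    have f1: "\<bar>f x\<bar> \<le> 1" for x using \<epsilon> infdist_nonneg[of x AX] by (auto simp: f_def)
    have "\<bar>f x - f y\<bar> \<le> dist x y" for x y
      using infdist_triangle_abs[of x AX y] unfolding f_def by linarith
    then have f2: "1-lipschitz_on UNIV f" by (intro lipschitz_onI) (auto simp: dist_real_def)
    have int: "integrable \<mu> f" "integrable \<nu> f"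
      using f1 f2 by (auto intro!: integrable_bounded_borel M.finite_measure_axioms
          N.finite_measure_axioms bounded_lipschitz_borel)
    have WK[simp]: "W \<inter> K \<in> sets borel" "UNIV - K \<in> sets borel" by (auto intro!: sets.Int sets.Diff)
    have WKU[simp]: "W \<inter> K \<union> (UNIV - K) \<in> sets borel" by (rule sets.Un) auto
    have f_ge: "\<epsilon> * indicator AX x \<le> f x" and f_le: "f x \<le> \<epsilon> * indicator W x" for x
      using \<epsilon> infdist_nonneg[of x AX] by (auto simp: f_def W_def indicator_def)
    have "\<epsilon> * measure \<mu> AX = (\<integral>x. \<epsilon> * indicator AX x \<partial>\<mu>)" by simp
    also have "\<dots> \<le> (\<integral>x. f x \<partial>\<mu>)"
      using f_ge by (intro integral_mono int integrable_mult_right integrable_real_indicator)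
        (auto simp: M.emeasure_eq_measure)
    also have "\<dots> \<le> (\<integral>x. f x \<partial>\<nu>) + \<epsilon>\<^sup>2"
      using integral_diff_le_dual_norm[OF \<mu> \<nu> f1 f2] \<epsilon>(3) by linarith
    also have "(\<integral>x. f x \<partial>\<nu>) \<le> (\<integral>x. \<epsilon> * indicator W x \<partial>\<nu>)"
      using f_le by (intro integral_mono int integrable_mult_right integrable_real_indicator)
        (auto simp: N.emeasure_eq_measure)
    also have "(\<integral>x. \<epsilon> * indicator W x \<partial>\<nu>) + \<epsilon>\<^sup>2 = \<epsilon> * (measure \<nu> W + \<epsilon>)"
      by (simp add: power2_eq_square algebra_simps)
    finally have "measure \<mu> AX \<le> measure \<nu> W + \<epsilon>" using \<epsilon> by simp
    also have "measure \<nu> W \<le> measure \<nu> (W \<inter> K \<union> (UNIV - K))"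
      by (intro N.finite_measure_mono) auto
    also have "\<dots> \<le> measure \<nu> (W \<inter> K) + measure \<nu> (UNIV - K)"
      by (intro measure_Un_le) auto
    also have "measure \<nu> (UNIV - K) \<le> \<epsilon>"
      using N.prob_compl[of K] NK by simp
    also have "measure \<nu> (W \<inter> K) \<le> measure \<nu> (\<Union>k\<in>N'. A k)"
    proof (rule N.finite_measure_mono)
      show "W \<inter> K \<subseteq> (\<Union>k\<in>N'. A k)"
      proof
        fix x assume x: "x \<in> W \<inter> K"
        then obtain k where k: "k < n" "x \<in> A k" using AK by blast
        have "(INF y\<in>AX. dist x y) < \<epsilon>"
          using x infdist_notempty[OF AX0, of x] by (simp add: W_def)
        then obtain y where "y \<in> AX" "dist x y < \<epsilon>"
          using AX0 by (subst (asm) cINF_less_iff) auto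
        then obtain i where i: "i \<in> X" "y \<in> A i" "dist x y < \<epsilon>" by (auto simp: AX_def)
        have "dist (p i) (p k) \<le> dist (p i) y + dist y x + dist x (p k)"
          using dist_triangle[of "p i" "p k" y] dist_triangle[of y "p k" x] by linarith
        also have "\<dots> < 3 * \<epsilon>"
          using A_ball[OF i(2)] A_ball[OF k(2)] i(3) by (simp add: dist_commute)
        finally show "x \<in> (\<Union>k\<in>N'. A k)" using i k by (auto simp: N'_def)
      qed
      show "(\<Union>k\<in>N'. A k) \<in> sets \<nu>" by (auto simp: N'_def)
    qed
    also have "\<dots> \<le> (\<Sum>k\<in>N'. measure \<nu> (A k))"
      by (intro N.finite_measure_subadditive_finite) (auto simp: N'_def)
    finally have "sum a X \<le> (\<Sum>k\<in>N'. measure \<nu> (A k)) + 2 * \<epsilon>"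
      using sumM[OF finX] by (simp add: a_def AX_def)
    also have "\<dots> = sum b (insert n N')"
      by (subst sum.insert) (auto simp: N'_def b_def intro!: sum.cong)
    also have "insert n N' = {k\<in>{..n}. \<exists>i\<in>X. R i k}"
      using False by (auto simp: N'_def R_def)
    finally show ?thesis .
  qed
  obtain c where c: "\<And>i k. 0 \<le> c i k"
    "\<And>i k. c i k \<noteq> 0 \<Longrightarrow> i \<in> {..<n} \<and> k \<in> {..n} \<and> R i k"
    "\<And>i. i \<in> {..<n} \<Longrightarrow> (\<Sum>k\<in>{..n}. c i k) = a i"
    "\<And>k. k \<in> {..n} \<Longrightarrow> (\<Sum>i\<in>{..<n}. c i k) \<le> b k"
    by (rule fractional_marriage[of "{..<n}" "{..n}" a b R])
       (use hall \<epsilon> that in \<open>auto simp: a_def b_def\<close>)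
  have row: "(\<Sum>k<n. c i k) = a i - c i n" if "i < n" for i
    using c(3)[of i] that by (simp flip: lessThan_Suc_atMost)
  show thesis
  proof (rule that[of A c n])
    show "(\<Sum>k<n. c i k) \<le> measure \<mu> (A i)" if "i < n" for i
      using row[OF that] c(1)[of i n] by (simp add: a_def)
    show "(\<Sum>i<n. c i k) \<le> measure \<nu> (A k)" if "k < n" for k
      using c(4)[of k] that by (simp add: b_def)
    \<comment> \<open>The loss is at most \<open>3 * \<epsilon>\<close>: the mass of \<mu> outside
      \<open>K\<close>, and whatever went to the fictitious block.\<close>
    have "(\<Sum>i<n. \<Sum>k<n. c i k) = (\<Sum>i<n. a i) - (\<Sum>i<n. c i n)"
      using row by (simp add: sum_subtractf)
    moreover have "(\<Sum>i<n. a i) = measure \<mu> K" unfolding a_def by (simp add: sumM AK)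
    moreover have "(\<Sum>i<n. c i n) \<le> 2 * \<epsilon>" using c(4)[of n] by (simp add: b_def)
    ultimately show "1 - 3 * \<epsilon> \<le> (\<Sum>i<n. \<Sum>k<n. c i k)" using MK by linarith
    show "dist x y \<le> 5 * \<epsilon>" if "i < n" "k < n" "c i k \<noteq> 0" "x \<in> A i" "y \<in> A k" for i k x y
    proof -
      have "dist (p i) (p k) < 3 * \<epsilon>" using c(2)[OF that(3)] that(2) by (simp add: R_def)
      moreover have "dist x y \<le> dist x (p i) + dist (p i) (p k) + dist (p k) y"
        using dist_triangle[of x y "p i"] dist_triangle[of "p i" y "p k"] by linarith
      ultimately show ?thesis
        using A_ball[OF that(4)] A_ball[OF that(5)] by (simp add: dist_commute)
    qed
  qed (use disj c(1) in auto)
qed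

section \<open>Realising all couplings on one sample space\<close>

lemma (in prob_space) distr_pair_snd: "sigma_finite_measure N \<Longrightarrow> distr (M \<Otimes>\<^sub>M N) N snd = N"
proof (intro measure_eqI)
  fix A assume "sigma_finite_measure N" and A: "A \<in> sets (distr (M \<Otimes>\<^sub>M N) N snd)"
  then interpret N: sigma_finite_measure N by simp
  have "emeasure (distr (M \<Otimes>\<^sub>M N) N snd) A = emeasure (M \<Otimes>\<^sub>M N) (space M \<times> A)"
    using A by (auto simp: emeasure_distr space_pair_measure dest: sets.sets_into_space intro!: arg_cong2[where f = emeasure])
  with A show "emeasure (distr (M \<Otimes>\<^sub>M N) N snd) A = emeasure N A"
    by (simp add: N.emeasure_pair_measure_Times emeasure_space_1)
qed simp

lemma AE_pair_fst:
  assumes "prob_space N" "AE x in M. P x"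
  shows "AE p in M \<Otimes>\<^sub>M N. P (fst p)"
proof (rule AE_distrD[where f = fst and P = P])
  show "AE x in distr (M \<Otimes>\<^sub>M N) M fst. P x"
    unfolding prob_space.distr_pair_fst[OF assms(1)] by (rule assms)
qed simp

lemma AE_pair_snd:
  assumes "prob_space M" "prob_space N" "AE y in N. P y"
  shows "AE p in M \<Otimes>\<^sub>M N. P (snd p)"
proof (rule AE_distrD[where f = snd and P = P])
  show "AE y in distr (M \<Otimes>\<^sub>M N) N snd. P y"
    unfolding prob_space.distr_pair_snd[OF assms(1) prob_space_imp_sigma_finite[OF assms(2)]]
    by (rule assms)
qed simp

text \<open>On a common sample space, the pair with index \<open>j\<close> is drawn from the good law \<open>G j\<close> when a
  single uniform variable exceeds \<open>q j\<close>, and from the bad law \<open>H j\<close> otherwise. Since \<open>q\<close> tends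
  to \<open>0\<close>, almost every sample uses only the good laws from some index on; this turns convergence
  in probability into almost sure convergence.\<close>

lemma as_asymptotic_representation_of_mixtures:
  fixes \<mu> \<nu> :: "nat \<Rightarrow> 'a::metric_space measure" and G H :: "nat \<Rightarrow> ('a \<times> 'a) measure"
  assumes G: "\<And>j. prob_space (G j)" "\<And>j. sets (G j) = sets (borel \<Otimes>\<^sub>M borel)"
    and H: "\<And>j. prob_space (H j)" "\<And>j. sets (H j) = sets (borel \<Otimes>\<^sub>M borel)"
    and \<mu>: "\<And>j. sets (\<mu> j) = sets borel" and \<nu>: "\<And>j. sets (\<nu> j) = sets borel"
    and q: "\<And>j. 0 \<le> q j" "\<And>j. q j \<le> 1" "q \<longlonglongrightarrow> 0" and \<delta>: "\<delta> \<longlonglongrightarrow> 0"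
    and mu: "\<And>j A. A \<in> sets borel \<Longrightarrow> emeasure (\<mu> j) A =
        ennreal (1 - q j) * emeasure (G j) (A \<times> UNIV) + ennreal (q j) * emeasure (H j) (A \<times> UNIV)"
    and nu: "\<And>j A. A \<in> sets borel \<Longrightarrow> emeasure (\<nu> j) A =
        ennreal (1 - q j) * emeasure (G j) (UNIV \<times> A) + ennreal (q j) * emeasure (H j) (UNIV \<times> A)"
    and good: "\<And>j. q j < 1 \<Longrightarrow> AE p in G j. dist (fst p) (snd p) \<le> \<delta> j"
  shows "\<exists>(\<Omega> :: (real \<times> (nat \<Rightarrow> ('a \<times> 'a) \<times> ('a \<times> 'a))) measure) X Y.
      as_asymptotic_representation \<Omega> X Y \<mu> \<nu>"
proof -
  define L where "L = uniform_measure lborel {0..1::real}"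
  define W where "W = PiM UNIV (\<lambda>j. G j \<Otimes>\<^sub>M H j)"
  define \<Omega> where "\<Omega> = L \<Otimes>\<^sub>M W"
  define Z where "Z j \<omega> = (if q j < fst \<omega> then fst (snd \<omega> j) else snd (snd \<omega> j))"
    for j and \<omega> :: "real \<times> (nat \<Rightarrow> ('a \<times> 'a) \<times> ('a \<times> 'a))"
  have L: "prob_space L" unfolding L_def by (intro prob_space_uniform_measure) auto
  have GH: "prob_space (G j \<Otimes>\<^sub>M H j)" for j using G H by (intro prob_space_pair)
  have W: "prob_space W" unfolding W_def using GH by (rule prob_space_PiM)
  have \<Omega>: "prob_space \<Omega>" unfolding \<Omega>_def using L W by (rule prob_space_pair)
  interpret W: prob_space W by fact
  have sL: "sets L = sets borel" "space L = UNIV" by (simp_all add: L_def)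
  have spG: "space (G j) = UNIV" "space (H j) = UNIV" for j
    using sets_eq_imp_space_eq[OF G(2)[of j]] sets_eq_imp_space_eq[OF H(2)[of j]]
    by (simp_all add: space_pair_measure)
  have spW: "space W = UNIV" by (simp add: W_def space_PiM space_pair_measure spG)
  have comp: "(\<lambda>w. w j) \<in> measurable W (G j \<Otimes>\<^sub>M H j)" for j
    unfolding W_def by (rule measurable_component_singleton) simp
  have mG: "(\<lambda>w. fst (w j)) \<in> measurable W (borel \<Otimes>\<^sub>M borel)" for j
    using measurable_compose[OF comp measurable_fst, of j]
    by (simp only: measurable_cong_sets[OF refl G(2)])
  have mH: "(\<lambda>w. snd (w j)) \<in> measurable W (borel \<Otimes>\<^sub>M borel)" for j
    using measurable_compose[OF comp measurable_snd, of j]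
    by (simp only: measurable_cong_sets[OF refl H(2)])
  have Z: "Z j \<in> measurable \<Omega> (borel \<Otimes>\<^sub>M borel)" for j
    unfolding Z_def \<Omega>_def
  proof (rule measurable_If)
    show "(\<lambda>x. fst (snd x j)) \<in> measurable (L \<Otimes>\<^sub>M W) (borel \<Otimes>\<^sub>M borel)"
      by (rule measurable_compose[OF measurable_snd mG])
    show "(\<lambda>x. snd (snd x j)) \<in> measurable (L \<Otimes>\<^sub>M W) (borel \<Otimes>\<^sub>M borel)"
      by (rule measurable_compose[OF measurable_snd mH])
    have "fst \<in> borel_measurable (L \<Otimes>\<^sub>M W)"
      using measurable_fst[of L W] by (simp only: measurable_cong_sets[OF refl sL(1)])
    then show "{x \<in> space (L \<Otimes>\<^sub>M W). q j < fst x} \<in> sets (L \<Otimes>\<^sub>M W)" by simp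
  qed
  have distr_W: "distr W (G j \<Otimes>\<^sub>M H j) (\<lambda>w. w j) = G j \<Otimes>\<^sub>M H j" for j
    unfolding W_def using GH by (intro distr_PiM_component) auto
  have eZ: "emeasure \<Omega> (Z j -` S \<inter> space \<Omega>) =
      ennreal (1 - q j) * emeasure (G j) S + ennreal (q j) * emeasure (H j) S"
    if S: "S \<in> sets (borel \<Otimes>\<^sub>M borel)" for j S
  proof -
    interpret Gj: prob_space "G j" by (rule G)
    interpret Hj: prob_space "H j" by (rule H)
    have "emeasure W {w. fst (w j) \<in> S} = emeasure (G j) S"
    proof -
      have "emeasure W {w. fst (w j) \<in> S} = emeasure (distr W (G j \<Otimes>\<^sub>M H j) (\<lambda>w. w j)) (S \<times> UNIV)"
        using S G(2)[of j] sets.top[of "H j"] comp[of j]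
        by (subst emeasure_distr) (auto simp: spW spG mem_Times_iff intro!: arg_cong[where f = "emeasure W"])
      also have "\<dots> = emeasure (G j) S"
        unfolding distr_W using S G(2)[of j] sets.top[of "H j"] Hj.emeasure_space_1
        by (simp add: Hj.emeasure_pair_measure_Times spG)
      finally show ?thesis .
    qed
    moreover have "emeasure W {w. snd (w j) \<in> S} = emeasure (H j) S"
    proof -
      have "emeasure W {w. snd (w j) \<in> S} = emeasure (distr W (G j \<Otimes>\<^sub>M H j) (\<lambda>w. w j)) (UNIV \<times> S)"
        using S H(2)[of j] sets.top[of "G j"] comp[of j]
        by (subst emeasure_distr) (auto simp: spW spG mem_Times_iff intro!: arg_cong[where f = "emeasure W"])
      also have "\<dots> = emeasure (H j) S"
        unfolding distr_W using S H(2)[of j] sets.top[of "G j"] Gj.emeasure_space_1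
        by (simp add: Hj.emeasure_pair_measure_Times spG)
      finally show ?thesis .
    qed
    moreover have "Pair T -` (Z j -` S \<inter> space \<Omega>) =
        (if q j < T then {w. fst (w j) \<in> S} else {w. snd (w j) \<in> S})" for T
      by (auto simp: Z_def \<Omega>_def space_pair_measure sL spW)
    ultimately have slice: "emeasure W (Pair T -` (Z j -` S \<inter> space \<Omega>)) =
        emeasure (G j) S * indicator {q j<..} T + emeasure (H j) S * indicator {..q j} T" for T
      by (auto simp: indicator_def)
    have "{0..1} \<inter> {q j<..} = {q j<..1}" "{0..1} \<inter> {..q j} = {0..q j}"
      using q(1)[of j] q(2)[of j] by auto
    then have l: "emeasure L {q j<..} = ennreal (1 - q j)" "emeasure L {..q j} = ennreal (q j)"
      using q(1,2)[of j] by (simp_all add: L_def emeasure_uniform_measure divide_ennreal_def)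
    have "Z j -` S \<inter> space \<Omega> \<in> sets (L \<Otimes>\<^sub>M W)"
      unfolding \<Omega>_def[symmetric] using Z S by (rule measurable_sets)
    then have "emeasure \<Omega> (Z j -` S \<inter> space \<Omega>) =
        (\<integral>\<^sup>+T. emeasure W (Pair T -` (Z j -` S \<inter> space \<Omega>)) \<partial>L)"
      unfolding \<Omega>_def by (rule W.emeasure_pair_measure_alt)
    also have "\<dots> = emeasure (G j) S * emeasure L {q j<..} + emeasure (H j) S * emeasure L {..q j}"
      unfolding slice by (subst nn_integral_add) (auto simp: sL nn_integral_cmult_indicator intro!: borel_measurable_times_ennreal borel_measurable_indicator)
    finally show ?thesis unfolding l by (simp add: mult.commute)
  qed
  have mX: "(\<lambda>\<omega>. fst (Z j \<omega>)) \<in> borel_measurable \<Omega>" and mY: "(\<lambda>\<omega>. snd (Z j \<omega>)) \<in> borel_measurable \<Omega>" for j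
    using measurable_compose[OF Z measurable_fst] measurable_compose[OF Z measurable_snd] by auto
  have "distr \<Omega> borel (\<lambda>\<omega>. fst (Z j \<omega>)) = \<mu> j" for j
  proof (rule measure_eqI)
    fix A assume "A \<in> sets (distr \<Omega> borel (\<lambda>\<omega>. fst (Z j \<omega>)))"
    then have A: "A \<in> sets borel" by simp
    then have "emeasure (distr \<Omega> borel (\<lambda>\<omega>. fst (Z j \<omega>))) A = emeasure \<Omega> (Z j -` (A \<times> UNIV) \<inter> space \<Omega>)"
      using mX by (subst emeasure_distr) (auto simp: vimage_def mem_Times_iff)
    also have "\<dots> = emeasure (\<mu> j) A" using A by (subst eZ) (auto simp: mu)
    finally show "emeasure (distr \<Omega> borel (\<lambda>\<omega>. fst (Z j \<omega>))) A = emeasure (\<mu> j) A" .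
  qed (simp add: \<mu>)
  moreover have "distr \<Omega> borel (\<lambda>\<omega>. snd (Z j \<omega>)) = \<nu> j" for j
  proof (rule measure_eqI)
    fix A assume "A \<in> sets (distr \<Omega> borel (\<lambda>\<omega>. snd (Z j \<omega>)))"
    then have A: "A \<in> sets borel" by simp
    then have "emeasure (distr \<Omega> borel (\<lambda>\<omega>. snd (Z j \<omega>))) A = emeasure \<Omega> (Z j -` (UNIV \<times> A) \<inter> space \<Omega>)"
      using mY by (subst emeasure_distr) (auto simp: vimage_def mem_Times_iff)
    also have "\<dots> = emeasure (\<nu> j) A" using A by (subst eZ) (auto simp: nu)
    finally show "emeasure (distr \<Omega> borel (\<lambda>\<omega>. snd (Z j \<omega>))) A = emeasure (\<nu> j) A" .
  qed (simp add: \<nu>)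
  moreover have "AE \<omega> in \<Omega>. (\<lambda>j. dist (fst (Z j \<omega>)) (snd (Z j \<omega>))) \<longlonglongrightarrow> 0"
  proof -
    \<comment> \<open>Only a positive \<open>T\<close> is sure to exceed \<open>q j\<close>
      eventually, so the null event \<open>T = 0\<close> is discarded.\<close>
    have "AE T in lborel. T \<in> {0..1} \<longrightarrow> 0 < (T::real)"
      using AE_lborel_singleton[of "0::real"] by eventually_elim auto
    then have "AE T in L. 0 < T"
      unfolding L_def by (subst AE_uniform_measure) auto
    then have T: "AE \<omega> in \<Omega>. 0 < fst \<omega>"
      unfolding \<Omega>_def using W by (rule AE_pair_fst[rotated])
    \<comment> \<open>For \<open>q j = 1\<close> the law \<open>G j\<close> is unconstrained; such
      indices disappear eventually because \<open>q\<close> tends to 0.\<close>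
    have "AE \<omega> in \<Omega>. q j < 1 \<longrightarrow> dist (fst (fst (snd \<omega> j))) (snd (fst (snd \<omega> j))) \<le> \<delta> j" for j
    proof (cases "q j < 1")
      case True
      then have "AE p in G j \<Otimes>\<^sub>M H j. dist (fst (fst p)) (snd (fst p)) \<le> \<delta> j"
        using H(1) good by (intro AE_pair_fst)
      then have "AE w in W. dist (fst (fst (w j))) (snd (fst (w j))) \<le> \<delta> j"
        unfolding W_def using GH by (intro AE_PiM_component) auto
      then have "AE \<omega> in \<Omega>. dist (fst (fst (snd \<omega> j))) (snd (fst (snd \<omega> j))) \<le> \<delta> j"
        unfolding \<Omega>_def using L W by (intro AE_pair_snd)
      then show ?thesis by eventually_elim simp
    qed simp
    then have "AE \<omega> in \<Omega>. \<forall>j. q j < 1 \<longrightarrow> dist (fst (fst (snd \<omega> j))) (snd (fst (snd \<omega> j))) \<le> \<delta> j"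
      by (simp add: AE_all_countable)
    with T show ?thesis
    proof eventually_elim
      case (elim \<omega>)
      have "eventually (\<lambda>j. q j < fst \<omega>) sequentially" "eventually (\<lambda>j. q j < 1) sequentially"
        using q(3) elim(1) by (auto intro: order_tendstoD)
      then have "eventually (\<lambda>j. norm (dist (fst (Z j \<omega>)) (snd (Z j \<omega>))) \<le> \<delta> j) sequentially"
        by eventually_elim (use elim(2) in \<open>simp add: Z_def\<close>)
      then show ?case using \<delta> by (rule Lim_null_comparison)
    qed
  qed
  ultimately show ?thesis
    using \<Omega> mX mY unfolding as_asymptotic_representation_def
    by (intro exI[of _ \<Omega>] exI[of _ "\<lambda>j \<omega>. fst (Z j \<omega>)"] exI[of _ "\<lambda>j \<omega>. snd (Z j \<omega>)"]) blast
qed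

lemma dual_norm_coupling:
  fixes \<mu> \<nu> :: "'a::metric_space measure"
  assumes \<mu>: "\<mu> \<in> tight_prob_measures UNIV" and \<nu>: "\<nu> \<in> tight_prob_measures UNIV"
    and \<epsilon>: "0 < \<epsilon>" "dual_norm (measure_diff \<mu> \<nu>) \<le> \<epsilon>\<^sup>2"
  shows "\<exists>G H q. prob_space G \<and> prob_space H \<and> sets G = sets (borel \<Otimes>\<^sub>M borel) \<and>
    sets H = sets (borel \<Otimes>\<^sub>M borel) \<and> 0 \<le> q \<and> q \<le> 1 \<and> q \<le> 3 * \<epsilon> \<and>
    (\<forall>X\<in>sets borel. emeasure \<mu> X =
        ennreal (1 - q) * emeasure G (X \<times> UNIV) + ennreal q * emeasure H (X \<times> UNIV)) \<and>
    (\<forall>X\<in>sets borel. emeasure \<nu> X =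
        ennreal (1 - q) * emeasure G (UNIV \<times> X) + ennreal q * emeasure H (UNIV \<times> X)) \<and>
    (q < 1 \<longrightarrow> (AE p in G. dist (fst p) (snd p) \<le> 5 * \<epsilon>))"
proof -
  note M = tight_prob_measuresD[OF \<mu>] and N = tight_prob_measuresD[OF \<nu>]
  have "\<exists>(n :: nat) A c. (\<forall>i. A i \<in> sets borel) \<and> disjoint_family A \<and> (\<forall>i k. 0 \<le> c i k) \<and>
    (\<forall>i<n. (\<Sum>k<n. c i k) \<le> measure \<mu> (A i)) \<and> (\<forall>k<n. (\<Sum>i<n. c i k) \<le> measure \<nu> (A k)) \<and>
    1 - 3 * \<epsilon> \<le> (\<Sum>i<n. \<Sum>k<n. c i k) \<and>
    (\<forall>i<n. \<forall>k<n. c i k \<noteq> 0 \<longrightarrow> (\<forall>x\<in>A i. \<forall>y\<in>A k. dist x y \<le> 5 * \<epsilon>))"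
  proof (cases "\<epsilon> < 1")
    case True
    show ?thesis by (rule block_transport[OF \<mu> \<nu> \<epsilon>(1) True \<epsilon>(2)]) blast
  next
    case False
    then show ?thesis
      \<comment> \<open>For \<open>\<epsilon> \<ge> 1\<close> no blocks are used: then
        \<open>q = 1\<close>, everything is bad, and \<open>q \<le> 3 * \<epsilon>\<close> still
        holds.\<close>
      by (intro exI[of _ 0] exI[of _ "\<lambda>_. {}"] exI[of _ "\<lambda>_ _. 0"]) (auto simp: disjoint_family_on_def)
  qed
  then obtain n :: nat and A c where A: "\<And>i. A i \<in> sets borel" "disjoint_family A"
    and c: "\<And>i k. 0 \<le> c i k" "\<And>i. i < n \<Longrightarrow> (\<Sum>k<n. c i k) \<le> measure \<mu> (A i)"
      "\<And>k. k < n \<Longrightarrow> (\<Sum>i<n. c i k) \<le> measure \<nu> (A k)"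
    and total: "1 - 3 * \<epsilon> \<le> (\<Sum>i<n. \<Sum>k<n. c i k)"
    and near: "\<And>i k x y. i < n \<Longrightarrow> k < n \<Longrightarrow> c i k \<noteq> 0 \<Longrightarrow> x \<in> A i \<Longrightarrow> y \<in> A k \<Longrightarrow> dist x y \<le> 5 * \<epsilon>"
    by blast
  define q where "q = 1 - (\<Sum>i<n. \<Sum>k<n. c i k)"
  have disj: "disjoint_family_on A {..<n}" using A(2) by (rule disjoint_family_on_mono[rotated]) simp
  have sets_eq: "sets (\<mu> \<Otimes>\<^sub>M \<nu>) = sets (borel \<Otimes>\<^sub>M borel)"
    using M(2) N(2) by (rule sets_pair_measure_cong)
  obtain G H where GH: "prob_space G" "prob_space H" "sets G = sets (\<mu> \<Otimes>\<^sub>M \<nu>)"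
    "sets H = sets (\<mu> \<Otimes>\<^sub>M \<nu>)" "0 \<le> q" "q \<le> 1"
    and mu: "\<And>X. X \<in> sets \<mu> \<Longrightarrow> emeasure \<mu> X =
        ennreal (1 - q) * emeasure G (X \<times> space \<nu>) + ennreal q * emeasure H (X \<times> space \<nu>)"
    and nu: "\<And>Y. Y \<in> sets \<nu> \<Longrightarrow> emeasure \<nu> Y =
        ennreal (1 - q) * emeasure G (space \<mu> \<times> Y) + ennreal q * emeasure H (space \<mu> \<times> Y)"
    and good: "q < 1 \<Longrightarrow> AE p in G. \<exists>i<n. \<exists>k<n. c i k \<noteq> 0 \<and> fst p \<in> A i \<and> snd p \<in> A k"
    unfolding q_def
    by (rule block_coupling[where M = \<mu> and N = \<nu> and A = A and B = A and n = n and c = c])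
      (use M N A(1) disj c that in \<open>simp_all only:\<close>)
  have "AE p in G. dist (fst p) (snd p) \<le> 5 * \<epsilon>" if "q < 1"
    using good[OF that] by eventually_elim (use near in blast)
  moreover have "q \<le> 3 * \<epsilon>" using total by (simp add: q_def)
  ultimately show ?thesis
    using GH(1,2,5,6) GH(3,4)[unfolded sets_eq] mu[unfolded M(2) N(3)] nu[unfolded N(2) M(3)]
    by (intro exI[of _ G] exI[of _ H] exI[of _ q] conjI ballI impI)
qed

lemma dual_norm_tendsto_imp_representation:
  fixes \<mu> \<nu> :: "nat \<Rightarrow> 'a::metric_space measure"
  assumes \<mu>: "\<And>j. \<mu> j \<in> tight_prob_measures UNIV"
    and \<nu>: "\<And>j. \<nu> j \<in> tight_prob_measures UNIV"
    and lim: "(\<lambda>j. dual_norm (measure_diff (\<mu> j) (\<nu> j))) \<longlonglongrightarrow> 0"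
  shows "\<exists>(\<Omega> :: (nat \<Rightarrow> 'a \<times> 'a) measure) X Y. as_asymptotic_representation \<Omega> X Y \<mu> \<nu>"
proof -
  define d where "d j = dual_norm (measure_diff (\<mu> j) (\<nu> j))" for j
  \<comment> \<open>The root matches the square required by \<open>dual_norm_coupling\<close>; the
    second term keeps \<open>\<epsilon> j\<close> positive when the norm is 0.\<close>
  define \<epsilon> where "\<epsilon> j = sqrt (d j) + inverse (real (Suc j))" for j
  have d0: "0 \<le> d j" for j unfolding d_def using \<mu> \<nu> by (rule dual_norm_nonneg)
  have \<epsilon>0: "0 < \<epsilon> j" for j using d0 by (simp add: \<epsilon>_def add_nonneg_pos)
  have "(\<lambda>j. sqrt (d j)) \<longlonglongrightarrow> sqrt 0" using lim unfolding d_def by (rule tendsto_real_sqrt)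
  then have \<epsilon>_lim: "\<epsilon> \<longlonglongrightarrow> 0"
    unfolding \<epsilon>_def using tendsto_add[OF _ LIMSEQ_inverse_real_of_nat] by fastforce
  have d_le: "d j \<le> (\<epsilon> j)\<^sup>2" for j
  proof -
    have "d j = (sqrt (d j))\<^sup>2" using d0 by simp
    also have "\<dots> \<le> (\<epsilon> j)\<^sup>2" using d0 by (intro power_mono) (auto simp: \<epsilon>_def)
    finally show ?thesis .
  qed
  define C where "C j G H q \<longleftrightarrow> prob_space G \<and> prob_space H \<and> sets G = sets (borel \<Otimes>\<^sub>M borel) \<and>
    sets H = sets (borel \<Otimes>\<^sub>M borel) \<and> 0 \<le> q \<and> q \<le> 1 \<and> q \<le> 3 * \<epsilon> j \<and>
    (\<forall>X\<in>sets borel. emeasure (\<mu> j) X =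
        ennreal (1 - q) * emeasure G (X \<times> UNIV) + ennreal q * emeasure H (X \<times> UNIV)) \<and>
    (\<forall>X\<in>sets borel. emeasure (\<nu> j) X =
        ennreal (1 - q) * emeasure G (UNIV \<times> X) + ennreal q * emeasure H (UNIV \<times> X)) \<and>
    (q < 1 \<longrightarrow> (AE p in G. dist (fst p) (snd p) \<le> 5 * \<epsilon> j))"
    for j and G H :: "('a \<times> 'a) measure" and q
  have "\<exists>G H q. C j G H q" for j
    using dual_norm_coupling[OF \<mu> \<nu> \<epsilon>0] d_le unfolding d_def C_def by blast
  then obtain G H q where C: "\<And>j. C j (G j) (H j) (q j)" by metis
  have GHq: "\<And>j. prob_space (G j)" "\<And>j. prob_space (H j)"
    "\<And>j. sets (G j) = sets (borel \<Otimes>\<^sub>M borel)" "\<And>j. sets (H j) = sets (borel \<Otimes>\<^sub>M borel)"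
    "\<And>j. 0 \<le> q j" "\<And>j. q j \<le> 1" "\<And>j. q j \<le> 3 * \<epsilon> j"
    "\<And>j X. X \<in> sets borel \<Longrightarrow> emeasure (\<mu> j) X =
        ennreal (1 - q j) * emeasure (G j) (X \<times> UNIV) + ennreal (q j) * emeasure (H j) (X \<times> UNIV)"
    "\<And>j X. X \<in> sets borel \<Longrightarrow> emeasure (\<nu> j) X =
        ennreal (1 - q j) * emeasure (G j) (UNIV \<times> X) + ennreal (q j) * emeasure (H j) (UNIV \<times> X)"
    "\<And>j. q j < 1 \<Longrightarrow> AE p in G j. dist (fst p) (snd p) \<le> 5 * \<epsilon> j"
    using C unfolding C_def by blast+
  have "(\<lambda>j. 3 * \<epsilon> j) \<longlonglongrightarrow> 0" "(\<lambda>j. 5 * \<epsilon> j) \<longlonglongrightarrow> 0"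
    using \<epsilon>_lim by (auto intro: tendsto_mult_right_zero)
  moreover from this(1) have "q \<longlonglongrightarrow> 0"
    using GHq(5,7) by (intro tendsto_sandwich[of "\<lambda>_. 0" q _ "\<lambda>j. 3 * \<epsilon> j"]) auto
  ultimately have "\<exists>(\<Omega> :: (real \<times> (nat \<Rightarrow> ('a \<times> 'a) \<times> ('a \<times> 'a))) measure) X Y.
      as_asymptotic_representation \<Omega> X Y \<mu> \<nu>"
    using GHq tight_prob_measuresD(2)[OF \<mu>] tight_prob_measuresD(2)[OF \<nu>]
    by (intro as_asymptotic_representation_of_mixtures[of G H \<mu> \<nu> q "\<lambda>j. 5 * \<epsilon> j"])
  \<comment> \<open>The mixture lives on its own sample space; the transfer lemma moves it to the
    type fixed in the statement.\<close>
  then show ?thesis using as_asymptotic_representation_sequence_space by blast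
qed

section \<open>The equivalence\<close>

theorem corollary11:
  fixes U :: "('a::metric_space measure \<times> 'a measure) filter"
    and \<mu> \<nu> :: "nat \<Rightarrow> 'a measure"
  assumes "uniform_structure_on (tight_prob_measures UNIV) U"
    and "property_A1 U"
    and "property_A2 U"
    and "\<And>j. \<mu> j \<in> tight_prob_measures UNIV"
    and "\<And>j. \<nu> j \<in> tight_prob_measures UNIV"
  shows "((\<forall>f\<in>bounded_uniformly_continuous_on UNIV.
             (\<lambda>j. (\<integral>x. f x \<partial>\<mu> j) - (\<integral>x. f x \<partial>\<nu> j)) \<longlonglongrightarrow> 0) \<longleftrightarrow>
          asymptotic_approximation (tight_prob_measures UNIV) U sequentially \<mu> \<nu>) \<and>
         (asymptotic_approximation (tight_prob_measures UNIV) U sequentially \<mu> \<nu> \<longleftrightarrow>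
          (\<lambda>j. dual_norm (measure_diff (\<mu> j) (\<nu> j))) \<longlonglongrightarrow> 0) \<and>
         ((\<lambda>j. dual_norm (measure_diff (\<mu> j) (\<nu> j))) \<longlonglongrightarrow> 0 \<longleftrightarrow>
          (\<exists>(\<Omega> :: (nat \<Rightarrow> 'a \<times> 'a) measure) X Y. as_asymptotic_representation \<Omega> X Y \<mu> \<nu>))"
    (is "(?i \<longleftrightarrow> ?ii) \<and> (?ii \<longleftrightarrow> ?iii) \<and> (?iii \<longleftrightarrow> ?iv)")
proof -
  have "?i \<Longrightarrow> ?iii"
    by (rule integral_diff_tendsto_imp_dual_norm_tendsto[OF assms(4,5)]) blast
  moreover have "?iii \<Longrightarrow> ?iv"
    using assms(4,5) by (rule dual_norm_tendsto_imp_representation)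
  moreover have "?iv \<Longrightarrow> ?ii"
    using assms(2,4,5) unfolding property_A1_def by blast
  moreover have "?ii \<Longrightarrow> ?i"
    by (intro ballI asymptotic_approximation_imp_integral_diff[OF assms(3) _ assms(4,5)])
  ultimately show ?thesis by blast
qed

end
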